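(* Let $\mathbb{F}$ be an arbitrary field and let $P(\lambda)=\sum_{k=0}^dP_k\lambda^k\in\mathbb{F}[\lambda]^{n\times n}$ be a singular matrix polynomial of odd degree $d$, with $s=(d-1)/2\ge1$. Let $\mathcal{L}(\lambda)$ be a strong linearization of $P(\lambda)$ obtained from a block Kronecker pencil, i.e. $$\mathcal{L}(\lambda)=\begin{bmatrix}\lambda B+A & L_s(\lambda)^T\otimes I_n\\ \sigma L_s(\lambda)\otimes I_n & 0\end{bmatrix},\qquad\sigma\in\{1,-1\},$$ where $\lambda B+A$ is an $(s+1)n\times(s+1)n$ pencil over $\mathbb{F}$ with $(\Lambda_s(\lambda)^T\otimes I_n)(\lambda B+A)(\Lambda_s(\lambda)\otimes I_n)=P(\lambda)$. Then: (a) If $\{z_1(\lambda),\dots,z_p(\lambda)\}$ is any right minimal basis of $\mathcal{L}(\lambda)$ and $x_j(\lambda)$ is the $(s+1)$th block of $z_j(\lambda)$ for $j=1,\dots,p$, then $\{x_1(\lambda),\dots,x_p(\lambda)\}$ is a right minimal basis of $P(\lambda)$. (b) If $0\le\epsilon_1\le\epsilon_2\le\cdots\le\epsilon_p$ are the right minimal indices of $P(\lambda)$, then $0\le\epsilon_1+s\le\epsilon_2+s\le\cdots\le\epsilon_p+s$ are the right minimal indices of $\mathcal{L}(\lambda)$.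
   Context: For $k\ge 1$, $L_k(\lambda)\in\mathbb{F}[\lambda]^{k\times(k+1)}$ is the matrix with $-1$ in the $(i,i)$ entries, $\lambda$ in the $(i,i+1)$ entries ($i=1,\dots,k$), and zeros elsewhere; $\Lambda_k(\lambda)^T=\begin{bmatrix}\lambda^k&\cdots&\lambda&1\end{bmatrix}$. A square matrix polynomial is singular if its determinant is identically zero. Column vectors of size $nd$ are partitioned into $d$ consecutive blocks of size $n$. The right nullspace of a matrix polynomial $R(\lambda)$ with $m$ columns is $\mathcal{N}_r(R)=\{x(\lambda)\in\mathbb{F}(\lambda)^{m\times1}:R(\lambda)x(\lambda)=0\}$. A right minimal basis of $R(\lambda)$ is a basis of $\mathcal{N}_r(R)$ over $\mathbb{F}(\lambda)$ consisting of vector polynomials such that the sum of their degrees is least among all such polynomial bases. The right minimal indices of $R(\lambda)$ are the degrees, listed in nondecreasing order, of the vectors in any right minimal basis (this list does not depend on the basis). *)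

theory Defs
  imports
    "Jordan_Normal_Form.Matrix_Kernel"
    "HOL-Computational_Algebra.Polynomial_Factorial"
begin

text \<open>
  Matrix polynomials over a field \<open>'a\<close> are matrices over \<open>'a poly\<close>; the field of rational
  functions is \<open>'a poly fract\<close>. All matrix entries are indexed from 0.
\<close>

definition poly_vec_degree :: "'a::zero poly vec \<Rightarrow> nat" where
  "poly_vec_degree v = Max (insert 0 (degree ` set\<^sub>v v))"

definition poly_mat_degree :: "'a::zero poly mat \<Rightarrow> nat" where
  "poly_mat_degree R = Max (insert 0 (degree ` elements_mat R))"

definition singular_poly_mat :: "'a::comm_ring_1 poly mat \<Rightarrow> bool" where
  "singular_poly_mat R \<longleftrightarrow> square_mat R \<and> det R = 0"

definition right_nullspace :: "'a::field poly mat \<Rightarrow> 'a poly fract vec set" where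
  "right_nullspace R = mat_kernel (map_mat to_fract R)"

text \<open>
  A family of vector polynomials is given as a list. It is a polynomial basis if its members are
  pairwise distinct and, read as rational vectors, form a basis of the right nullspace as a vector
  space over the rational functions.
\<close>

definition right_polynomial_basis :: "'a::field poly mat \<Rightarrow> 'a poly vec list \<Rightarrow> bool" where
  "right_polynomial_basis R zs \<longleftrightarrow>
     distinct zs \<and>
     vectorspace.basis class_ring
       (module_vec TYPE('a poly fract) (dim_col R) \<lparr>carrier := right_nullspace R\<rparr>)
       (map_vec to_fract ` set zs)"

definition right_minimal_basis :: "'a::field poly mat \<Rightarrow> 'a poly vec list \<Rightarrow> bool" where
  "right_minimal_basis R zs \<longleftrightarrow>
     right_polynomial_basis R zs \<and>
     (\<forall>ws. right_polynomial_basis R ws \<longrightarrow>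
        sum_list (map poly_vec_degree zs) \<le> sum_list (map poly_vec_degree ws))"

text \<open>
  The description is proper because a right minimal basis exists and the sorted list of degrees is
  the same for all of them.
\<close>

definition right_minimal_indices :: "'a::field poly mat \<Rightarrow> nat list" where
  "right_minimal_indices R =
     (THE es. \<exists>zs. right_minimal_basis R zs \<and> es = sort (map poly_vec_degree zs))"

definition kronecker_prod :: "'a::times mat \<Rightarrow> 'a mat \<Rightarrow> 'a mat"  (infixl "\<otimes>\<^sub>K" 72) where
  "A \<otimes>\<^sub>K B =
     mat (dim_row A * dim_row B) (dim_col A * dim_col B)
       (\<lambda>(i, j). A $$ (i div dim_row B, j div dim_col B) * B $$ (i mod dim_row B, j mod dim_col B))"

definition L_mat :: "nat \<Rightarrow> 'a::field poly mat" where
  "L_mat k = mat k (k + 1) (\<lambda>(i, j). if j = i then -1 else if j = i + 1 then [:0, 1:] else 0)"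

text \<open>The column \<open>[\<lambda>^k, \<dots>, \<lambda>, 1]\<close>, as a matrix with a single column.\<close>

definition Lambda_mat :: "nat \<Rightarrow> 'a::field poly mat" where
  "Lambda_mat k = mat (k + 1) 1 (\<lambda>(i, j). monom 1 (k - i))"

text \<open>The pencil \<open>\<lambda> B + A\<close>.\<close>

definition pencil :: "'a::field mat \<Rightarrow> 'a mat \<Rightarrow> 'a poly mat" where
  "pencil B A = [:0, 1:] \<cdot>\<^sub>m map_mat (\<lambda>c. [:c:]) B + map_mat (\<lambda>c. [:c:]) A"

definition block_kronecker_pencil ::
  "nat \<Rightarrow> nat \<Rightarrow> 'a::field \<Rightarrow> 'a mat \<Rightarrow> 'a mat \<Rightarrow> 'a poly mat" where
  "block_kronecker_pencil n s \<sigma> B A =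
     four_block_mat
       (pencil B A)                          ((L_mat s)\<^sup>T \<otimes>\<^sub>K 1\<^sub>m n)
       (([:\<sigma>:] \<cdot>\<^sub>m L_mat s) \<otimes>\<^sub>K 1\<^sub>m n)    (0\<^sub>m (s * n) (s * n))"

text \<open>The \<open>j\<close>-th block of size \<open>n\<close>, blocks being counted from 1.\<close>

definition vec_block :: "nat \<Rightarrow> nat \<Rightarrow> 'a vec \<Rightarrow> 'a vec" where
  "vec_block n j v = vec n (\<lambda>i. v $ ((j - 1) * n + i))"

end

theory Submission
  imports Defs "Subresultants.More_Homomorphisms"
begin

text \<open>
  A vector \<open>z = (u, y)\<close> is in the nullspace of the pencil iff \<open>u = \<Lambda> \<otimes> x\<close>, where \<open>x\<close> is the last block of
  \<open>u\<close>, the block \<open>y\<close> is a polynomial expression in \<open>u\<close>, and \<open>P x = 0\<close>. So taking the \<open>(s + 1)\<close>th block is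
  an isomorphism of nullspaces that respects polynomial vectors in both directions, and it lowers the
  degree of every nonzero polynomial vector by exactly \<open>s\<close>. As all bases of the nullspace have the same
  length, minimal bases correspond to minimal bases. That the minimal indices are well defined is the
  matroid fact that two bases of least total weight have the same multiset of weights.
\<close>

text \<open>Why \<open>P x = 0\<close> appears: since L_s \<Lambda>_s = 0, multiplying the upper
  block row by \<Lambda>^T \<otimes> I removes \<open>y\<close> and leaves exactly
  \<open>P x\<close>. Conversely, that row consists of \<open>s + 1\<close> block equations for the
  \<open>s\<close> blocks of \<open>y\<close>, and \<open>P x = 0\<close> is their one compatibility
  condition. The obstacle is the degree of \<open>y\<close>. Its explicit formula contains powers of
  the indeterminate that seem to push the degree above \<open>s\<close> plus the degree of
  \<open>x\<close>. The condition \<open>P x = 0\<close> forces the excess to cancel, which becomes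
  visible when the same equations are solved from the other end. The explicit lift is used over two
  rings. Over the rational functions it shows that taking the block is onto. Over the polynomials it
  sends polynomial vectors to polynomial vectors with no denominators to clear, so the competitors
  in the two minimisation problems correspond one to one.\<close>

subsection \<open>Bases of least weight\<close>

text \<open>Steinitz exchange with control over what leaves: as \<open>w\<close> is outside
  \<open>span Y\<close>, its expansion in \<open>Z\<close> has a nonzero coefficient outside
  \<open>Y\<close>. With \<open>Y\<close> the light members of a basis, a heavy member is thrown
  out.\<close>

lemma (in vectorspace) basis_exchange:
  assumes fin: "finite Z" and Z: "basis Z" and Y: "Y \<subseteq> Z"
    and w: "w \<in> carrier V" and wY: "w \<notin> span Y"
  obtains z where "z \<in> Z - Y" "basis (insert w (Z - {z}))"
proof (cases "w \<in> Z")
  case True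
  have "Z \<subseteq> carrier V" using Z by (auto simp: basis_def)
  then have "w \<notin> Y" using wY Y in_own_span[of Y] by blast
  then show ?thesis using that[of w] True Z by (simp add: insert_absorb)
next
  case False
  have ZC: "Z \<subseteq> carrier V" using Z by (auto simp: basis_def)
  have "w \<in> span Z" using Z w by (auto simp: basis_def)
  then obtain a where a: "a \<in> Z \<rightarrow> carrier K" and wa: "w = lincomb a Z"
    using finite_span[OF fin ZC] by auto
  have "\<exists>z \<in> Z - Y. a z \<noteq> \<zero>\<^bsub>K\<^esub>"
  proof (rule ccontr)
    assume "\<not> ?thesis"
    then have "lincomb a (Z - Y) = \<zero>\<^bsub>V\<^esub>"
      by (intro lincomb_zero) (use ZC in auto)
    moreover have "lincomb a (Y \<union> (Z - Y)) = lincomb a Y \<oplus>\<^bsub>V\<^esub> lincomb a (Z - Y)"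
      using Y ZC a fin by (intro lincomb_union) (auto simp: Pi_def finite_subset[OF Y])
    moreover have "Y \<union> (Z - Y) = Z" using Y by auto
    moreover have "lincomb a Y \<in> carrier V" using Y ZC a by (intro lincomb_closed) auto
    ultimately have "w = lincomb a Y" using wa by simp
    moreover have "finite Y" "a \<in> Y \<rightarrow> carrier K" "Y \<subseteq> carrier V"
      using finite_subset[OF Y fin] a Y ZC by auto
    ultimately show False using wY finite_span[of Y] by auto
  qed
  then obtain z where z: "z \<in> Z" "z \<notin> Y" and az: "a z \<noteq> \<zero>\<^bsub>K\<^esub>" by auto
  \<comment> \<open>Coefficient -1 on \<open>w\<close> turns the expansion of \<open>w\<close> into
    a vanishing combination over \<open>insert w Z\<close>, from which \<open>z\<close> can be
    isolated because its coefficient is nonzero.\<close>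
  let ?b = "\<lambda>v. if v = w then \<ominus>\<^bsub>K\<^esub> \<one>\<^bsub>K\<^esub> else a v"
  have b: "?b \<in> insert w Z \<rightarrow> carrier K" using a by auto
  have "lincomb ?b Z = lincomb a Z"
    using ZC a False by (intro lincomb_elim_if) auto
  then have "lincomb ?b (insert w Z) = \<ominus>\<^bsub>K\<^esub> \<one>\<^bsub>K\<^esub> \<odot>\<^bsub>V\<^esub> w \<oplus>\<^bsub>V\<^esub> w"
    using lincomb_insert2[OF fin ZC b False w] wa by simp
  also have "\<dots> = \<zero>\<^bsub>V\<^esub>" using w by (simp add: smult_minus_1 M.l_neg)
  finally have "z \<in> span (insert w Z - {z})"
    by (intro lincomb_isolate(2)[OF _ _ b]) (use fin ZC w z az False in auto)
  moreover have "insert w Z - {z} = insert w (Z - {z})" using False z by auto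
  ultimately have "basis (insert w (Z - {z}))"
    using basis_swap[of "Z - {z}" z w] fin z ZC w Z by (auto simp: insert_absorb)
  then show ?thesis using that z by auto
qed

text \<open>The greedy argument: if \<open>W\<close> had more members of weight at most
  \<open>k\<close>, one of them would lie outside the span of the light part of \<open>Z\<close> and
  could replace a heavier member, which contradicts minimality. \<open>S\<close> is the pool from
  which competing bases are drawn, later the polynomial vectors among the rational ones.\<close>

lemma (in vectorspace) min_weight_basis_card_le:
  fixes wt :: "'c \<Rightarrow> nat"
  assumes fd: "fin_dim"
    and Z: "basis Z" "Z \<subseteq> S" and W: "basis W" "W \<subseteq> S"
    and min: "\<And>B. basis B \<Longrightarrow> B \<subseteq> S \<Longrightarrow> sum wt Z \<le> sum wt B"
  shows "card {w \<in> W. wt w \<le> k} \<le> card {z \<in> Z. wt z \<le> k}"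
proof (rule ccontr)
  let ?W = "{w \<in> W. wt w \<le> k}" and ?Z = "{z \<in> Z. wt z \<le> k}"
  assume less: "\<not> card ?W \<le> card ?Z"
  have fin: "finite Z" "finite W"
    using Z W fin[OF fd] by (auto simp: basis_def)
  have C: "Z \<subseteq> carrier V" "W \<subseteq> carrier V" using Z W by (auto simp: basis_def)
  have finWZ: "finite ?W" "finite ?Z" and ZC: "?Z \<subseteq> carrier V" using fin C by auto
  have "\<not> ?W \<subseteq> span ?Z"
  proof
    assume sub: "?W \<subseteq> span ?Z"
    have "lin_indpt ?W" using W subset_li_is_li[of W ?W] by (auto simp: basis_def)
    \<comment> \<open>Only the size bound of the replacement theorem is kept: \<open>card C\<close>
      is nonnegative, so an independent set inside \<open>span ?Z\<close> is not larger than
      \<open>?Z\<close>.\<close>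
    then have "\<exists>C::'c set. int (card C) \<le> int (card ?Z) - int (card ?W)"
      using replacement[OF finWZ ZC _ sub] by blast
    then show False using less by auto
  qed
  then obtain w where w: "w \<in> W" "wt w \<le> k" "w \<notin> span ?Z" by auto
  obtain z where z: "z \<in> Z - ?Z" and B: "basis (insert w (Z - {z}))"
    using basis_exchange[OF fin(1) Z(1) _ _ w(3)] C w by auto
  have "sum wt Z \<le> sum wt (insert w (Z - {z}))"
    using B Z W w by (intro min) auto
  also have "\<dots> \<le> wt w + sum wt (Z - {z})"
    using fin by (simp add: sum.insert_if)
  finally show False using sum.remove[of Z z wt] fin z w by auto
qed

text \<open>By symmetry, both bases have equally many members of weight at most \<open>j\<close> for
  every \<open>j\<close>; differences of consecutive counts give the multiplicity of each
  weight.\<close>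

lemma (in vectorspace) min_weight_bases_same_weights:
  fixes wt :: "'c \<Rightarrow> nat"
  assumes fd: "fin_dim"
    and Z: "basis Z" "Z \<subseteq> S" and minZ: "\<And>B. basis B \<Longrightarrow> B \<subseteq> S \<Longrightarrow> sum wt Z \<le> sum wt B"
    and W: "basis W" "W \<subseteq> S" and minW: "\<And>B. basis B \<Longrightarrow> B \<subseteq> S \<Longrightarrow> sum wt W \<le> sum wt B"
  shows "image_mset wt (mset_set Z) = image_mset wt (mset_set W)"
proof (rule multiset_eqI)
  fix k
  have fin: "finite Z" "finite W"
    using Z W fin[OF fd] by (auto simp: basis_def)
  have eq: "card {w \<in> W. wt w \<le> j} = card {z \<in> Z. wt z \<le> j}" for j
    using min_weight_basis_card_le[OF fd Z W minZ] min_weight_basis_card_le[OF fd W Z minW]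
    by (simp add: le_antisym)
  \<comment> \<open>The case \<open>k = 0\<close> stands apart because \<open>k - 1\<close> would
    truncate to 0 and count weight 0 twice.\<close>
  have split: "card {x \<in> X. wt x \<le> k} = card {x \<in> X. wt x = k} + (if k = 0 then 0 else card {x \<in> X. wt x \<le> k - 1})"
    if "finite X" for X
  proof (cases "k = 0")
    case False
    then have "{x \<in> X. wt x \<le> k} = {x \<in> X. wt x = k} \<union> {x \<in> X. wt x \<le> k - 1}" by auto
    moreover have "{x \<in> X. wt x = k} \<inter> {x \<in> X. wt x \<le> k - 1} = {}" using False by auto
    ultimately show ?thesis using that False by (simp add: card_Un_disjoint)
  qed simp
  have count: "count (image_mset wt (mset_set X)) k = card {x \<in> X. wt x = k}" if "finite X" for X
    using that by (simp add: count_image_mset vimage_def Int_def conj_commute)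
  have "card {w \<in> W. wt w = k} = card {z \<in> Z. wt z = k}"
    using split[OF fin(1)] split[OF fin(2)] eq[of k] eq[of "k - 1"] by (auto split: if_splits)
  then show "count (image_mset wt (mset_set Z)) k = count (image_mset wt (mset_set W)) k"
    using count fin by simp
qed

text \<open>The inverse map is linear and bijective too, so this is the preservation of bases
  applied to it. Finite dimension is therefore asked of \<open>W\<close>, the source of the inverse.
  It serves to pull a basis of the nullspace of \<open>P\<close> back to the pencil.\<close>

lemma (in linear_map) basis_of_basis_image:
  assumes inj: "inj_on T (carrier V)" and surj: "T ` carrier V = carrier W"
    and fd: "W.fin_dim" and A: "A \<subseteq> carrier V" and TA: "W.basis (T ` A)"
  shows "V.basis A"
proof -
  let ?S = "inv_into (carrier V) T"
  have TS: "T (?S y) = y" and SC: "?S y \<in> carrier V" if "y \<in> carrier W" for y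
    using that surj by (auto simp: f_inv_into_f inv_into_into)
  have ST: "?S (T x) = x" if "x \<in> carrier V" for x
    using that inj by (rule inv_into_f_f[rotated])
  have add: "?S (x \<oplus>\<^bsub>W\<^esub> y) = ?S x \<oplus>\<^bsub>V\<^esub> ?S y" if "x \<in> carrier W" "y \<in> carrier W" for x y
    using ST[of "?S x \<oplus>\<^bsub>V\<^esub> ?S y"] TS SC that by simp
  have smult: "?S (c \<odot>\<^bsub>W\<^esub> y) = c \<odot>\<^bsub>V\<^esub> ?S y" if "c \<in> carrier K" "y \<in> carrier W" for c y
    using ST[of "c \<odot>\<^bsub>V\<^esub> ?S y"] TS SC that by simp
  have lin: "linear_map K W V ?S"
    by (simp add: linear_map_def mod_hom_def mod_hom_axioms_def LinearCombinations.module_hom_def SC add smult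
        V.vectorspace_axioms W.vectorspace_axioms V.module.module_axioms W.module.module_axioms)
  have "?S ` T ` A = A" using A ST by (simp add: image_image subset_iff)
  moreover have "V.basis (?S ` T ` A)"
  proof (rule linear_map.linear_inj_image_is_basis[OF lin _ _ TA fd])
    show "inj_on ?S (carrier W)" by (metis TS inj_onI)
    show "?S ` carrier W = carrier V"
      using ST by (simp add: surj[symmetric] image_image)
  qed
  ultimately show ?thesis by simp
qed

subsection \<open>Kernels of block Kronecker pencils\<close>

lemma block_index_less:
  fixes n :: nat
  assumes "i < m" "a < n"
  shows "i * n + a < m * n"
proof -
  have "Suc i * n \<le> m * n" using assms by (intro mult_le_mono1) simp
  then show ?thesis using assms by simp
qed

lemma eq_vec_blocksI:
  assumes "v \<in> carrier_vec (m * n)" "w \<in> carrier_vec (m * n)"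
    and "\<And>i a. i < m \<Longrightarrow> a < n \<Longrightarrow> v $ (i * n + a) = w $ (i * n + a)"
  shows "v = w"
proof (rule eq_vecI)
  fix k assume "k < dim_vec w"
  then have k: "k < m * n" using assms by simp
  then have "n > 0" by (cases n) auto
  then have "k mod n < n" "k div n < m" using k by (simp_all add: less_mult_imp_div_less)
  from assms(3)[OF this(2,1)] show "v $ k = w $ k" by simp
qed (use assms in auto)

lemma vec_block_carrier [simp]: "vec_block n j v \<in> carrier_vec n"
  by (simp add: vec_block_def)

section \<open>Kronecker products with an identity factor, acting blockwise\<close>

lemma kronecker_prod_carrier [simp]:
  "A \<in> carrier_mat m k \<Longrightarrow> B \<in> carrier_mat p q \<Longrightarrow> A \<otimes>\<^sub>K B \<in> carrier_mat (m * p) (k * q)"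
  by (simp add: kronecker_prod_def)

text \<open>The identity factor couples only entries at the same position \<open>a\<close> of their
  blocks, so in the sum over each block a single term survives.\<close>

lemma kronecker_one_mult_vec_index:
  fixes A :: "'b::comm_ring_1 mat"
  assumes A: "A \<in> carrier_mat m k" and v: "v \<in> carrier_vec (k * n)" and i: "i < m" and a: "a < n"
  shows "((A \<otimes>\<^sub>K 1\<^sub>m n) *\<^sub>v v) $ (i * n + a) = (\<Sum>j<k. A $$ (i, j) * v $ (j * n + a))"
proof -
  let ?f = "\<lambda>l. A $$ (i, l div n) * 1\<^sub>m n $$ (a, l mod n) * v $ l"
  have "((A \<otimes>\<^sub>K 1\<^sub>m n) *\<^sub>v v) $ (i * n + a) = (\<Sum>l<k * n. ?f l)"
    using A v i a block_index_less[OF i a]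
    by (simp add: kronecker_prod_def scalar_prod_def lessThan_atLeast0)
  also have "\<dots> = (\<Sum>j<k. \<Sum>l\<in>{j * n..<j * n + n}. ?f l)"
    by (rule sum.nat_group[symmetric])
  also have "\<dots> = (\<Sum>j<k. A $$ (i, j) * v $ (j * n + a))"
  proof (rule sum.cong[OF refl])
    fix j
    have "(\<Sum>l\<in>{j * n..<j * n + n}. ?f l)
        = (\<Sum>l\<in>{j * n..<j * n + n}. if l = j * n + a then A $$ (i, j) * v $ (j * n + a) else 0)"
    proof (rule sum.cong[OF refl])
      fix l assume "l \<in> {j * n..<j * n + n}"
      then obtain b where "l = j * n + b" "b < n"
        by (metis atLeastLessThan_iff le_Suc_ex nat_add_left_cancel_less)
      then show "?f l = (if l = j * n + a then A $$ (i, j) * v $ (j * n + a) else 0)"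
        using a by simp
    qed
    then show "(\<Sum>l\<in>{j * n..<j * n + n}. ?f l) = A $$ (i, j) * v $ (j * n + a)"
      using a by simp
  qed
  finally show ?thesis .
qed

text \<open>
  Versions of \<open>L_mat\<close>, \<open>Lambda_mat\<close> and the block Kronecker pencil with the indeterminate replaced
  by a parameter \<open>t\<close>, so that the same computation serves polynomial and rational vectors.
\<close>

definition shift_mat :: "nat \<Rightarrow> 'b::comm_ring_1 \<Rightarrow> 'b mat" where
  "shift_mat k t = mat k (k + 1) (\<lambda>(i, j). if j = i then -1 else if j = i + 1 then t else 0)"

definition power_col :: "nat \<Rightarrow> 'b::comm_ring_1 \<Rightarrow> 'b mat" where
  "power_col k t = mat (k + 1) 1 (\<lambda>(i, j). t ^ (k - i))"

definition kron_pencil :: "nat \<Rightarrow> nat \<Rightarrow> 'b::comm_ring_1 \<Rightarrow> 'b \<Rightarrow> 'b mat \<Rightarrow> 'b mat" where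
  "kron_pencil n s t c M =
     four_block_mat M ((shift_mat s t)\<^sup>T \<otimes>\<^sub>K 1\<^sub>m n) ((c \<cdot>\<^sub>m shift_mat s t) \<otimes>\<^sub>K 1\<^sub>m n) (0\<^sub>m (s * n) (s * n))"

text \<open>
  The lower part \<open>y\<close> is determined by forward substitution in the block bidiagonal system
  \<open>M u + (L\<^sup>T \<otimes> I) y = 0\<close>; the last block row of the system is the one expressing \<open>P x = 0\<close>.
\<close>

definition kron_lift :: "nat \<Rightarrow> nat \<Rightarrow> 'b::comm_ring_1 \<Rightarrow> 'b mat \<Rightarrow> 'b vec \<Rightarrow> 'b vec" where
  "kron_lift n s t M x =
     (let u = (power_col s t \<otimes>\<^sub>K 1\<^sub>m n) *\<^sub>v x in
      u @\<^sub>v vec (s * n) (\<lambda>k. \<Sum>j\<le>k div n. t ^ (k div n - j) * (M *\<^sub>v u) $ (j * n + k mod n)))"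

lemma shift_mat_carrier [simp]: "shift_mat k t \<in> carrier_mat k (Suc k)"
  by (simp add: shift_mat_def)

lemma power_col_carrier [simp]: "power_col k t \<in> carrier_mat (Suc k) (Suc 0)"
  by (simp add: power_col_def)

lemma power_col_kron_carrier: "power_col s t \<otimes>\<^sub>K 1\<^sub>m n \<in> carrier_mat ((s + 1) * n) n"
  using kronecker_prod_carrier[of "power_col s t" "s + 1" 1 "1\<^sub>m n" n n] by simp

lemma power_row_kron_carrier: "(power_col s t)\<^sup>T \<otimes>\<^sub>K 1\<^sub>m n \<in> carrier_mat n ((s + 1) * n)"
  using kronecker_prod_carrier[of "(power_col s t)\<^sup>T" 1 "s + 1" "1\<^sub>m n" n n] by simp

lemma kron_pencil_carrier [simp]:
  "M \<in> carrier_mat ((s + 1) * n) ((s + 1) * n) \<Longrightarrow>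
   kron_pencil n s t c M \<in> carrier_mat ((s + 1) * n + s * n) ((s + 1) * n + s * n)"
  unfolding kron_pencil_def by (rule four_block_carrier_mat) auto

lemma power_col_kron_mult_index:
  assumes "x \<in> carrier_vec n" "i \<le> s" "a < n"
  shows "((power_col s t \<otimes>\<^sub>K 1\<^sub>m n) *\<^sub>v x) $ (i * n + a) = t ^ (s - i) * x $ a"
  using assms by (subst kronecker_one_mult_vec_index[OF power_col_carrier]) (auto simp: power_col_def)

lemma power_row_kron_mult_index:
  assumes "w \<in> carrier_vec ((s + 1) * n)" "a < n"
  shows "(((power_col s t)\<^sup>T \<otimes>\<^sub>K 1\<^sub>m n) *\<^sub>v w) $ a = (\<Sum>j\<le>s. t ^ (s - j) * w $ (j * n + a))"
proof -
  have "(power_col s t)\<^sup>T \<in> carrier_mat 1 (s + 1)" by simp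
  from kronecker_one_mult_vec_index[OF this assms(1) _ assms(2), of 0] show ?thesis
    by (simp add: power_col_def lessThan_Suc_atMost)
qed

lemma shift_kron_mult_index:
  assumes "u \<in> carrier_vec ((s + 1) * n)" "i < s" "a < n"
  shows "(((c \<cdot>\<^sub>m shift_mat s t) \<otimes>\<^sub>K 1\<^sub>m n) *\<^sub>v u) $ (i * n + a)
    = c * (t * u $ ((i + 1) * n + a) - u $ (i * n + a))"
proof -
  have C: "c \<cdot>\<^sub>m shift_mat s t \<in> carrier_mat s (s + 1)" by simp
  have "(((c \<cdot>\<^sub>m shift_mat s t) \<otimes>\<^sub>K 1\<^sub>m n) *\<^sub>v u) $ (i * n + a)
      = (\<Sum>j<s + 1. (c \<cdot>\<^sub>m shift_mat s t) $$ (i, j) * u $ (j * n + a))"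
    by (rule kronecker_one_mult_vec_index[OF C assms])
  also have "\<dots> = (\<Sum>j<s + 1. (if j = i then - (c * u $ (i * n + a)) else 0)
      + (if j = i + 1 then c * t * u $ ((i + 1) * n + a) else 0))"
    by (rule sum.cong) (use assms in \<open>auto simp: shift_mat_def\<close>)
  also have "\<dots> = c * (t * u $ ((i + 1) * n + a) - u $ (i * n + a))"
    using assms by (subst sum.distrib) (simp add: algebra_simps)
  finally show ?thesis .
qed

lemma shift_transpose_kron_mult_index:
  assumes "y \<in> carrier_vec (s * n)" "i \<le> s" "a < n"
  shows "(((shift_mat s t)\<^sup>T \<otimes>\<^sub>K 1\<^sub>m n) *\<^sub>v y) $ (i * n + a)
    = (if i = 0 then 0 else t * y $ ((i - 1) * n + a)) - (if i = s then 0 else y $ (i * n + a))"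
proof -
  have C: "(shift_mat s t)\<^sup>T \<in> carrier_mat (s + 1) s" by simp
  have "(((shift_mat s t)\<^sup>T \<otimes>\<^sub>K 1\<^sub>m n) *\<^sub>v y) $ (i * n + a)
      = (\<Sum>j<s. (shift_mat s t)\<^sup>T $$ (i, j) * y $ (j * n + a))"
    by (rule kronecker_one_mult_vec_index[OF C]) (use assms in auto)
  \<comment> \<open>For \<open>i = 0\<close> the truncated \<open>i - 1\<close> is 0 as well, hence
    the inner guard; for \<open>i = s\<close> the condition \<open>j = i\<close> is never met below
    \<open>s\<close>.\<close>
  also have "\<dots> = (\<Sum>j<s. (if j = i then - y $ (i * n + a) else 0)
      + (if j = i - 1 then (if i = 0 then 0 else t * y $ ((i - 1) * n + a)) else 0))"
    by (rule sum.cong) (use assms in \<open>auto simp: shift_mat_def\<close>)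
  also have "\<dots> = (if i = 0 then 0 else t * y $ ((i - 1) * n + a)) - (if i = s then 0 else y $ (i * n + a))"
    using assms by (subst sum.distrib) auto
  finally show ?thesis .
qed

text \<open>The lower block row makes the blocks of \<open>u\<close> a geometric progression. The
  upper one is a first-order recurrence for the blocks of \<open>y\<close>, with zero in place of
  the missing blocks before the first and after the last; the condition at \<open>i = s\<close> is
  the compatibility condition.\<close>

lemma kron_pencil_mult_eq_0_iff:
  fixes t c :: "'b::comm_ring_1"
  assumes M: "M \<in> carrier_mat ((s + 1) * n) ((s + 1) * n)" and c: "c * c = 1"
    and u: "u \<in> carrier_vec ((s + 1) * n)" and y: "y \<in> carrier_vec (s * n)"
  shows "kron_pencil n s t c M *\<^sub>v (u @\<^sub>v y) = 0\<^sub>v ((s + 1) * n + s * n) \<longleftrightarrow>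
    (\<forall>i<s. \<forall>a<n. u $ (i * n + a) = t * u $ ((i + 1) * n + a)) \<and>
    (\<forall>i\<le>s. \<forall>a<n. (M *\<^sub>v u) $ (i * n + a) + (if i = 0 then 0 else t * y $ ((i - 1) * n + a))
       = (if i = s then 0 else y $ (i * n + a)))"
    (is "?Z \<longleftrightarrow> ?U \<and> ?Y")
proof -
  let ?S = "(c \<cdot>\<^sub>m shift_mat s t) \<otimes>\<^sub>K 1\<^sub>m n" and ?T = "(shift_mat s t)\<^sup>T \<otimes>\<^sub>K 1\<^sub>m n"
  have S: "?S \<in> carrier_mat (s * n) ((s + 1) * n)"
    by (rule kronecker_prod_carrier) auto
  have T: "?T \<in> carrier_mat ((s + 1) * n) (s * n)"
    by (rule kronecker_prod_carrier) auto
  have Su: "?S *\<^sub>v u \<in> carrier_vec (s * n)" and Ty: "?T *\<^sub>v y \<in> carrier_vec ((s + 1) * n)"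
    and Mu: "M *\<^sub>v u \<in> carrier_vec ((s + 1) * n)"
    using S T M u y mult_mat_vec_carrier by blast+
  have 0: "(0\<^sub>v ((s + 1) * n + s * n) :: 'b vec) = 0\<^sub>v ((s + 1) * n) @\<^sub>v 0\<^sub>v (s * n)" by auto
  have "kron_pencil n s t c M *\<^sub>v (u @\<^sub>v y)
      = (M *\<^sub>v u + ?T *\<^sub>v y) @\<^sub>v (?S *\<^sub>v u + 0\<^sub>m (s * n) (s * n) *\<^sub>v y)"
    unfolding kron_pencil_def by (rule four_block_mat_mult_vec[OF M T S zero_carrier_mat u y])
  also have "?S *\<^sub>v u + 0\<^sub>m (s * n) (s * n) *\<^sub>v y = ?S *\<^sub>v u"
  proof -
    have "0\<^sub>m (s * n) (s * n) *\<^sub>v y = 0\<^sub>v (s * n)"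
      using y by (intro eq_vecI) (auto simp: scalar_prod_def)
    then show ?thesis using Su by simp
  qed
  finally have mult: "kron_pencil n s t c M *\<^sub>v (u @\<^sub>v y) = (M *\<^sub>v u + ?T *\<^sub>v y) @\<^sub>v (?S *\<^sub>v u)" .
  have "M *\<^sub>v u + ?T *\<^sub>v y \<in> carrier_vec ((s + 1) * n)" using Mu Ty by (rule add_carrier_vec)
  from append_vec_eq[OF this zero_carrier_vec]
  have "?Z \<longleftrightarrow> M *\<^sub>v u + ?T *\<^sub>v y = 0\<^sub>v ((s + 1) * n) \<and> ?S *\<^sub>v u = 0\<^sub>v (s * n)"
    unfolding 0 mult .
  moreover have "?S *\<^sub>v u = 0\<^sub>v (s * n) \<longleftrightarrow> ?U"
  proof -
    have "?S *\<^sub>v u = 0\<^sub>v (s * n) \<longleftrightarrow>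
        (\<forall>i<s. \<forall>a<n. c * (t * u $ ((i + 1) * n + a) - u $ (i * n + a)) = 0)"
    proof (intro iffI allI impI)
      fix i a assume 0: "?S *\<^sub>v u = 0\<^sub>v (s * n)" and ia: "i < s" "a < n"
      show "c * (t * u $ ((i + 1) * n + a) - u $ (i * n + a)) = 0"
        using shift_kron_mult_index[OF u ia, of c t] block_index_less[OF ia] by (simp add: 0)
    next
      assume "\<forall>i<s. \<forall>a<n. c * (t * u $ ((i + 1) * n + a) - u $ (i * n + a)) = 0"
      then show "?S *\<^sub>v u = 0\<^sub>v (s * n)"
        using Su shift_kron_mult_index[OF u, of _ _ c t] block_index_less
        by (intro eq_vec_blocksI[of _ s n]) simp_all
    qed
    \<comment> \<open>Multiplying by \<open>c\<close> once more cancels it; the ring may have zero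
      divisors.\<close>
    moreover have "c * b = 0 \<longleftrightarrow> b = 0" for b :: 'b
      by (metis c mult.assoc mult_1 mult_zero_right)
    ultimately show ?thesis by auto
  qed
  moreover have "M *\<^sub>v u + ?T *\<^sub>v y = 0\<^sub>v ((s + 1) * n) \<longleftrightarrow> ?Y"
  proof -
    have ind: "(M *\<^sub>v u + ?T *\<^sub>v y) $ (i * n + a) = (M *\<^sub>v u) $ (i * n + a)
        + (if i = 0 then 0 else t * y $ ((i - 1) * n + a)) - (if i = s then 0 else y $ (i * n + a))"
      if "i \<le> s" "a < n" for i a
    proof -
      have "i * n + a < dim_vec (?T *\<^sub>v y)"
        unfolding carrier_vecD[OF Ty] using that by (intro block_index_less) auto
      then show ?thesis
        using shift_transpose_kron_mult_index[OF y that, of t]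
        by (simp only: index_add_vec(1) add_diff_eq)
    qed
    show ?thesis
    proof (intro iffI allI impI)
      fix i a assume 0: "M *\<^sub>v u + ?T *\<^sub>v y = 0\<^sub>v ((s + 1) * n)" and ia: "i \<le> s" "a < n"
      show "(M *\<^sub>v u) $ (i * n + a) + (if i = 0 then 0 else t * y $ ((i - 1) * n + a))
         = (if i = s then 0 else y $ (i * n + a))"
        using ind[OF ia] block_index_less[of i "s + 1" a n] ia unfolding 0 by simp
    next
      assume eq: ?Y
      show "M *\<^sub>v u + ?T *\<^sub>v y = 0\<^sub>v ((s + 1) * n)"
      proof (rule eq_vec_blocksI)
        fix i a assume ia: "i < s + 1" "a < n"
        have "(M *\<^sub>v u + ?T *\<^sub>v y) $ (i * n + a) = 0"
          using ind[of i a] eq ia by auto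
        then show "(M *\<^sub>v u + ?T *\<^sub>v y) $ (i * n + a) = 0\<^sub>v ((s + 1) * n) $ (i * n + a)"
          using block_index_less[OF ia] by simp
      qed (use Mu Ty in auto)
    qed
  qed
  ultimately show ?thesis by blast
qed

text \<open>Horner's rule. It identifies the result of forward substitution, continued up to index
  \<open>s\<close>, with the product by the row of powers, and hence with an entry of
  \<open>P x\<close>.\<close>

lemma convolution_recurrence:
  fixes t :: "'b::comm_ring_1"
  shows "(\<Sum>j\<le>Suc i. t ^ (Suc i - j) * w j) = w (Suc i) + t * (\<Sum>j\<le>i. t ^ (i - j) * w j)"
proof -
  have "(\<Sum>j\<le>i. t ^ (Suc i - j) * w j) = (\<Sum>j\<le>i. t * (t ^ (i - j) * w j))"
    by (rule sum.cong) (auto simp: Suc_diff_le mult.assoc)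
  then show ?thesis by (simp add: sum_distrib_left)
qed

text \<open>The lower block row recovers \<open>u\<close> from its last block, the first
  \<open>s\<close> upper block equations recover \<open>y\<close> from \<open>u\<close>, and the
  last upper equation is left over to say that the matrix product annihilates
  \<open>x\<close>.\<close>

lemma kron_pencil_kernelD:
  fixes t c :: "'b::comm_ring_1"
  assumes M: "M \<in> carrier_mat ((s + 1) * n) ((s + 1) * n)" and c: "c * c = 1" and s: "s \<ge> 1"
    and z: "z \<in> carrier_vec ((s + 1) * n + s * n)"
    and 0: "kron_pencil n s t c M *\<^sub>v z = 0\<^sub>v ((s + 1) * n + s * n)"
  defines "x \<equiv> vec_block n (s + 1) z"
  shows "(((power_col s t)\<^sup>T \<otimes>\<^sub>K 1\<^sub>m n) * M * (power_col s t \<otimes>\<^sub>K 1\<^sub>m n)) *\<^sub>v x = 0\<^sub>v n"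
    and "z = kron_lift n s t M x"
proof -
  define u where "u = vec_first z ((s + 1) * n)"
  define y where "y = vec_last z (s * n)"
  have u: "u \<in> carrier_vec ((s + 1) * n)" and y: "y \<in> carrier_vec (s * n)"
    and zuy: "z = u @\<^sub>v y"
    using z by (simp_all add: u_def y_def)
  let ?P = "power_col s t \<otimes>\<^sub>K 1\<^sub>m n" and ?Q = "(power_col s t)\<^sup>T \<otimes>\<^sub>K 1\<^sub>m n"
  have Q: "?Q \<in> carrier_mat n ((s + 1) * n)"
    by (rule power_row_kron_carrier)
  have P: "?P \<in> carrier_mat ((s + 1) * n) n"
    by (rule power_col_kron_carrier)
  have x: "x \<in> carrier_vec n" by (simp add: x_def)
  note eqs = 0[unfolded zuy kron_pencil_mult_eq_0_iff[OF M c u y]]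
  have xu: "x $ a = u $ (s * n + a)" if "a < n" for a
    using that u block_index_less[of s "s + 1" a n] by (simp add: x_def vec_block_def zuy)
  \<comment> \<open>The progression is known at its last block, block \<open>s\<close> when counted
    from 0, so the induction runs backwards from there.\<close>
  have "u $ ((s - i) * n + a) = t ^ i * x $ a" if "i \<le> s" "a < n" for i a
    using that
  proof (induction i)
    case 0
    then show ?case by (simp add: xu)
  next
    case (Suc i)
    have "u $ ((s - Suc i) * n + a) = t * u $ ((s - Suc i + 1) * n + a)"
      using eqs Suc.prems by auto
    moreover have "s - Suc i + 1 = s - i" using Suc.prems by simp
    moreover have "u $ ((s - i) * n + a) = t ^ i * x $ a" using Suc by simp
    ultimately show ?case by (simp only: power_Suc mult.assoc)
  qed
  then have ui: "u $ (i * n + a) = t ^ (s - i) * x $ a" if "i \<le> s" "a < n" for i a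
    using that by (metis diff_diff_cancel diff_le_self)
  have uP: "u = ?P *\<^sub>v x"
    by (rule eq_vec_blocksI[OF u])
      (use P x ui power_col_kron_mult_index[OF x] in \<open>auto simp del: index_mult_mat_vec\<close>)
  have yi: "y $ (i * n + a) = (\<Sum>j\<le>i. t ^ (i - j) * (M *\<^sub>v u) $ (j * n + a))"
    if "i < s" "a < n" for i a
    using that
  proof (induction i)
    case 0
    have "(M *\<^sub>v u) $ (0 * n + a) + (if (0::nat) = 0 then 0 else t * y $ ((0 - 1) * n + a))
       = (if 0 = s then 0 else y $ (0 * n + a))" using eqs 0 by blast
    then show ?case using s by simp
  next
    case (Suc i)
    have "(M *\<^sub>v u) $ (Suc i * n + a) + t * y $ (i * n + a) = y $ (Suc i * n + a)"
      using conjunct2[OF eqs, rule_format, of "Suc i" a] Suc.prems by simp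
    then show ?case unfolding convolution_recurrence using Suc by simp
  qed
  have Mu: "M *\<^sub>v u \<in> carrier_vec ((s + 1) * n)" using M u by auto
  show "z = kron_lift n s t M x"
    unfolding kron_lift_def Let_def uP[symmetric] zuy
  proof (rule arg_cong[of _ _ "append_vec u"], rule eq_vec_blocksI[OF y vec_carrier])
    fix i a assume "i < s" "a < n"
    then show "y $ (i * n + a) = vec (s * n) (\<lambda>k. \<Sum>j\<le>k div n. t ^ (k div n - j) *
         (M *\<^sub>v u) $ (j * n + k mod n)) $ (i * n + a)"
      using yi[of i a] block_index_less[of i s a n] by simp
  qed
  have "(?Q * M * ?P) *\<^sub>v x = ?Q *\<^sub>v (M *\<^sub>v u)"
    using Q M P x unfolding uP by (simp add: assoc_mult_mat_vec[of _ n "(s + 1) * n" _ n])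
  also have "\<dots> = 0\<^sub>v n"
  proof (rule eq_vecI)
    fix a assume "a < dim_vec (0\<^sub>v n)"
    then have a: "a < n" by simp
    obtain r where r: "s = Suc r" using s by (cases s) auto
    have "(?Q *\<^sub>v (M *\<^sub>v u)) $ a = (\<Sum>j\<le>s. t ^ (s - j) * (M *\<^sub>v u) $ (j * n + a))"
      by (rule power_row_kron_mult_index[OF Mu a])
    also have "\<dots> = (M *\<^sub>v u) $ (s * n + a) + t * y $ (r * n + a)"
      unfolding r convolution_recurrence using yi[of r a] r a by simp
    also have "\<dots> = 0"
      using conjunct2[OF eqs, rule_format, of s a] r a by simp
    finally show "(?Q *\<^sub>v (M *\<^sub>v u)) $ a = 0\<^sub>v n $ a" using a by simp
  qed (use Q in simp)
  finally show "(?Q * M * ?P) *\<^sub>v x = 0\<^sub>v n" .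
qed

text \<open>All block equations except the last upper one hold by the construction of the lift; the
  hypothesis on \<open>x\<close> supplies that one.\<close>

lemma kron_lift_kernel:
  fixes t c :: "'b::comm_ring_1"
  assumes M: "M \<in> carrier_mat ((s + 1) * n) ((s + 1) * n)" and c: "c * c = 1" and s: "s \<ge> 1"
    and x: "x \<in> carrier_vec n"
    and 0: "(((power_col s t)\<^sup>T \<otimes>\<^sub>K 1\<^sub>m n) * M * (power_col s t \<otimes>\<^sub>K 1\<^sub>m n)) *\<^sub>v x = 0\<^sub>v n"
  shows "kron_lift n s t M x \<in> carrier_vec ((s + 1) * n + s * n)"
    and "kron_pencil n s t c M *\<^sub>v kron_lift n s t M x = 0\<^sub>v ((s + 1) * n + s * n)"
    and "vec_block n (s + 1) (kron_lift n s t M x) = x"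
proof -
  let ?P = "power_col s t \<otimes>\<^sub>K 1\<^sub>m n" and ?Q = "(power_col s t)\<^sup>T \<otimes>\<^sub>K 1\<^sub>m n"
  have Q: "?Q \<in> carrier_mat n ((s + 1) * n)"
    by (rule power_row_kron_carrier)
  have P: "?P \<in> carrier_mat ((s + 1) * n) n"
    by (rule power_col_kron_carrier)
  define u where "u = ?P *\<^sub>v x"
  define y where "y = vec (s * n) (\<lambda>k. \<Sum>j\<le>k div n. t ^ (k div n - j) * (M *\<^sub>v u) $ (j * n + k mod n))"
  have lift: "kron_lift n s t M x = u @\<^sub>v y"
    by (simp add: kron_lift_def u_def y_def Let_def)
  have u: "u \<in> carrier_vec ((s + 1) * n)" and y: "y \<in> carrier_vec (s * n)"
    using P x unfolding u_def y_def by auto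
  then show "kron_lift n s t M x \<in> carrier_vec ((s + 1) * n + s * n)"
    unfolding lift by simp
  have ui: "u $ (i * n + a) = t ^ (s - i) * x $ a" if "i \<le> s" "a < n" for i a
    unfolding u_def by (rule power_col_kron_mult_index[OF x that])
  show "vec_block n (s + 1) (kron_lift n s t M x) = x"
  proof (rule eq_vecI)
    fix a assume "a < dim_vec x"
    then have a: "a < n" using x by simp
    then show "vec_block n (s + 1) (kron_lift n s t M x) $ a = x $ a"
      unfolding lift using u ui[of s a] block_index_less[of s "s + 1" a n]
      by (simp add: vec_block_def)
  qed (use x in \<open>simp add: vec_block_def\<close>)
  have Mu: "M *\<^sub>v u \<in> carrier_vec ((s + 1) * n)" using M u by auto
  have yi: "y $ (i * n + a) = (\<Sum>j\<le>i. t ^ (i - j) * (M *\<^sub>v u) $ (j * n + a))"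
    if "i < s" "a < n" for i a
    using that block_index_less[OF that] by (simp add: y_def)
  have Qsum: "(\<Sum>j\<le>s. t ^ (s - j) * (M *\<^sub>v u) $ (j * n + a)) = 0" if a: "a < n" for a
  proof -
    have "(?Q * M * ?P) *\<^sub>v x = ?Q *\<^sub>v (M *\<^sub>v u)"
      using Q M P x unfolding u_def by (simp add: assoc_mult_mat_vec[of _ n "(s + 1) * n" _ n])
    then have "?Q *\<^sub>v (M *\<^sub>v u) = 0\<^sub>v n" using 0 by metis
    then show ?thesis using power_row_kron_mult_index[OF Mu a, of t] a by simp
  qed
  show "kron_pencil n s t c M *\<^sub>v kron_lift n s t M x = 0\<^sub>v ((s + 1) * n + s * n)"
    unfolding lift kron_pencil_mult_eq_0_iff[OF M c u y]
  proof (intro conjI allI impI)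
    fix i a assume "i < s" "a < n"
    then show "u $ (i * n + a) = t * u $ ((i + 1) * n + a)"
      using ui[of i a] ui[of "i + 1" a]
      by (simp add: Suc_diff_Suc[symmetric] mult.assoc del: Suc_diff_Suc)
  next
    fix i a assume ia: "i \<le> s" "a < n"
    let ?w = "\<lambda>j. (M *\<^sub>v u) $ (j * n + a)"
    have "?w i + (if i = 0 then 0 else t * y $ ((i - 1) * n + a)) = (\<Sum>j\<le>i. t ^ (i - j) * ?w j)"
    proof (cases i)
      case (Suc r)
      then have "r < s" using ia by simp
      with Suc show ?thesis unfolding Suc convolution_recurrence using yi[of r a] ia by simp
    qed simp
    \<comment> \<open>Below \<open>s\<close> the sum is the definition of \<open>y\<close>; at
      \<open>s\<close> it is an entry of the vector assumed to be zero.\<close>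
    also have "\<dots> = (if i = s then 0 else y $ (i * n + a))"
      using yi[of i a] Qsum[of a] ia by simp
    finally show "?w i + (if i = 0 then 0 else t * y $ ((i - 1) * n + a))
       = (if i = s then 0 else y $ (i * n + a))" .
  qed
qed

subsection \<open>Minimal bases and minimal indices\<close>

abbreviation nullspace_module ::
  "'a::field poly mat \<Rightarrow> ('a poly fract, 'a poly fract vec) module" where
  "nullspace_module R \<equiv> module_vec TYPE('a poly fract) (dim_col R) \<lparr>carrier := right_nullspace R\<rparr>"

lemma kernel_to_fract: "kernel (dim_row R) (dim_col R) (map_mat to_fract R)"
  by unfold_locales simp

lemma nullspace_vectorspace: "vectorspace class_ring (nullspace_module R)"
proof -
  interpret kernel "dim_row R" "dim_col R" "map_mat to_fract R" by (rule kernel_to_fract)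
  show ?thesis unfolding right_nullspace_def by (rule Ker.vectorspace_axioms)
qed

lemma nullspace_fin_dim: "vectorspace.fin_dim class_ring (nullspace_module R)"
proof -
  interpret kernel "dim_row R" "dim_col R" "map_mat to_fract R" by (rule kernel_to_fract)
  obtain B where "finite B" "basis B"
    using kernel_basis_exists[of "map_mat to_fract R" "dim_row R" "dim_col R"] by auto
  then show ?thesis
    unfolding right_nullspace_def Ker.fin_dim_def by (auto simp: Ker.basis_def)
qed

lemma right_nullspace_iff:
  "x \<in> right_nullspace R \<longleftrightarrow>
     x \<in> carrier_vec (dim_col R) \<and> map_mat to_fract R *\<^sub>v x = 0\<^sub>v (dim_row R)"
  by (auto simp: right_nullspace_def mat_kernel_def)

lemma to_fract_vec_in_right_nullspace_iff:
  assumes "v \<in> carrier_vec (dim_col R)"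
  shows "map_vec to_fract v \<in> right_nullspace R \<longleftrightarrow> R *\<^sub>v v = 0\<^sub>v (dim_row R)"
proof -
  have "map_mat to_fract R *\<^sub>v map_vec to_fract v = map_vec to_fract (R *\<^sub>v v)"
    by (rule to_fract_hom.mult_mat_vec_hom[symmetric, OF _ assms]) auto
  then show ?thesis using assms by (simp add: right_nullspace_iff)
qed

lemma inj_map_vec_to_fract: "inj (map_vec (to_fract :: 'a::idom \<Rightarrow> _))"
  by (rule injI) (rule to_fract_hom.vec_hom_inj)

section \<open>Existence of polynomial and of minimal bases\<close>

lemma common_denominator:
  fixes F :: "'a::idom fract set"
  assumes "finite F"
  shows "\<exists>c. c \<noteq> 0 \<and> (\<forall>q\<in>F. to_fract c * q \<in> range to_fract)"
  using assms
proof induction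
  case empty
  then show ?case by (intro exI[of _ 1]) simp
next
  case (insert q F)
  then obtain c where c: "c \<noteq> 0" "\<forall>q\<in>F. to_fract c * q \<in> range to_fract" by auto
  obtain a b where q: "q = Fract a b" "b \<noteq> 0" by (cases q)
  have "to_fract (b * c) * r \<in> range to_fract" if r: "r \<in> F" for r
  proof -
    obtain p where "to_fract c * r = to_fract p" using bspec[OF c(2) r] by (rule imageE)
    then have "to_fract (b * c) * r = to_fract (b * p)" by (simp add: mult.assoc)
    then show ?thesis by blast
  qed
  moreover have "to_fract (b * c) * q = to_fract (c * a)"
    using q by (simp add: Fract_conv_to_fract)
  ultimately have "\<forall>r\<in>insert q F. to_fract (b * c) * r \<in> range to_fract" by blast
  moreover have "b * c \<noteq> 0" using c q by simp
  ultimately show ?case by blast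
qed

lemma linear_map_nullspaceI:
  assumes "\<And>x. x \<in> right_nullspace R \<Longrightarrow> T x \<in> right_nullspace Q"
    and "\<And>x y. x \<in> right_nullspace R \<Longrightarrow> y \<in> right_nullspace R \<Longrightarrow> T (x + y) = T x + T y"
    and "\<And>c x. x \<in> right_nullspace R \<Longrightarrow> T (c \<cdot>\<^sub>v x) = c \<cdot>\<^sub>v T x"
  shows "linear_map class_ring (nullspace_module R) (nullspace_module Q) T"
proof -
  interpret V: vectorspace class_ring "nullspace_module R" by (rule nullspace_vectorspace)
  interpret W: vectorspace class_ring "nullspace_module Q" by (rule nullspace_vectorspace)
  show ?thesis
    using assms
    by (simp add: linear_map_def mod_hom_def mod_hom_axioms_def LinearCombinations.module_hom_def
        V.vectorspace_axioms W.vectorspace_axioms V.module.module_axioms W.module.module_axioms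
        module_vec_simps)
qed

text \<open>One denominator is taken for all entries of all basis vectors, so that clearing it is
  multiplication by a single nonzero scalar. This is an automorphism of the nullspace and thus
  preserves bases.\<close>

lemma right_polynomial_basis_exists: "\<exists>zs. right_polynomial_basis R zs"
proof -
  interpret V: vectorspace class_ring "nullspace_module R" by (rule nullspace_vectorspace)
  obtain B where B: "finite B" "V.basis B"
    using V.finite_basis_exists nullspace_fin_dim by auto
  have "finite (\<Union>v\<in>B. set\<^sub>v v)" using B by (auto simp: vec_set_def)
  then obtain c where c: "c \<noteq> 0"
    and int: "\<And>v q. v \<in> B \<Longrightarrow> q \<in> set\<^sub>v v \<Longrightarrow> to_fract c * q \<in> range to_fract"
    using common_denominator by (metis UN_iff)
  let ?c = "to_fract c"
  let ?T = "\<lambda>v. ?c \<cdot>\<^sub>v v"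
  have c0: "?c \<noteq> 0" using c by simp
  have closed: "k \<cdot>\<^sub>v x \<in> right_nullspace R" if "x \<in> right_nullspace R" for k x
    using that unfolding right_nullspace_def by (rule mat_kernel_smult[rotated]) auto
  have lin: "linear_map class_ring (nullspace_module R) (nullspace_module R) ?T"
  proof (rule linear_map_nullspaceI)
    fix x y assume "x \<in> right_nullspace R" "y \<in> right_nullspace R"
    then show "?T (x + y) = ?T x + ?T y"
      by (intro smult_add_distrib_vec) (auto simp: right_nullspace_iff)
  qed (auto simp: closed smult_smult_assoc mult.commute)
  have inverse: "inverse ?c \<cdot>\<^sub>v (?c \<cdot>\<^sub>v x) = x" "?c \<cdot>\<^sub>v (inverse ?c \<cdot>\<^sub>v x) = x" for x
    using c0 by (simp_all add: smult_smult_assoc)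
  have TB: "V.basis (?T ` B)"
  proof (rule linear_map.linear_inj_image_is_basis[OF lin _ _ B(2) nullspace_fin_dim])
    show "inj_on ?T (carrier (nullspace_module R))" by (metis inverse(1) inj_onI)
    show "?T ` carrier (nullspace_module R) = carrier (nullspace_module R)"
      using closed inverse(2) by (auto simp: image_iff) metis
  qed
  have "?T ` B \<subseteq> range (map_vec to_fract)"
  proof
    fix w assume "w \<in> ?T ` B"
    then obtain v where v: "v \<in> B" "w = ?T v" by auto
    have "\<exists>p. w $ i = to_fract p" if "i < dim_vec w" for i
      using int[OF v(1) vec_setI[of v i]] that v(2) by auto
    then obtain f where "\<And>i. i < dim_vec w \<Longrightarrow> w $ i = to_fract (f i)" by metis
    then have "w = map_vec to_fract (vec (dim_vec w) f)" by (intro eq_vecI) auto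
    then show "w \<in> range (map_vec to_fract)" by blast
  qed
  then obtain Z where Z: "?T ` B = map_vec to_fract ` Z" by (auto simp: subset_image_iff)
  have "finite Z"
    using B(1) Z finite_imageD[of "map_vec to_fract" Z] inj_on_subset[OF inj_map_vec_to_fract]
    by (metis finite_imageI subset_UNIV)
  then obtain zs where "set zs = Z" "distinct zs" using finite_distinct_list by auto
  then show ?thesis
    using TB Z by (auto simp: right_polynomial_basis_def)
qed

lemma right_minimal_basis_exists: "\<exists>zs. right_minimal_basis R zs"
proof -
  obtain zs where "right_polynomial_basis R zs" using right_polynomial_basis_exists by blast
  from ex_has_least_nat[of "right_polynomial_basis R", OF this,
      of "\<lambda>zs. sum_list (map poly_vec_degree zs)"]
  show ?thesis by (auto simp: right_minimal_basis_def)
qed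

text \<open>The uniqueness of weights is applied with the embedded polynomial vectors as the pool
  \<open>S\<close>.\<close>

lemma right_minimal_basis_degrees_unique:
  assumes zs: "right_minimal_basis R zs" and ws: "right_minimal_basis R ws"
  shows "mset (map poly_vec_degree zs) = mset (map poly_vec_degree ws)"
proof -
  interpret V: vectorspace class_ring "nullspace_module R" by (rule nullspace_vectorspace)
  let ?h = "map_vec to_fract"
  \<comment> \<open>Bases consist of rational vectors while degrees belong to polynomial ones; the
    embedding is injective, so the degree can be read back on its range, where all compared bases
    lie.\<close>
  define wt where "wt v = poly_vec_degree (inv_into UNIV ?h v)" for v :: "'a poly fract vec"
  have inj: "inj_on ?h X" for X :: "'a poly vec set"
    using inj_on_subset[OF inj_map_vec_to_fract] by blast
  have wt: "wt (?h v) = poly_vec_degree v" for v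
    by (simp add: wt_def inv_f_f[OF inj_map_vec_to_fract])
  have sum: "sum_list (map poly_vec_degree xs) = sum wt (?h ` set xs)" if "distinct xs" for xs
    using that by (simp add: sum_list_distinct_conv_sum_set sum.reindex[OF inj] wt)
  have ms: "mset (map poly_vec_degree xs) = image_mset wt (mset_set (?h ` set xs))"
    if "distinct xs" for xs
    using that
    by (simp add: image_mset_mset_set[OF inj, symmetric] mset_set_set multiset.map_comp o_def wt)
  have min: "sum wt (?h ` set xs) \<le> sum wt B"
    if xs: "right_minimal_basis R xs" and B: "V.basis B" "B \<subseteq> range ?h" for xs B
  proof -
    obtain Y where Y: "B = ?h ` Y" using B(2) by (auto simp: subset_image_iff)
    have "finite B" using B(1) V.fin[OF nullspace_fin_dim] by (auto simp: V.basis_def)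
    then have "finite Y" unfolding Y using finite_imageD[OF _ inj] by blast
    then obtain ys where ys: "set ys = Y" "distinct ys" using finite_distinct_list by auto
    then have "right_polynomial_basis R ys" using B Y by (simp add: right_polynomial_basis_def)
    then show ?thesis
      using xs sum[of xs] sum[of ys] ys Y
      by (auto simp: right_minimal_basis_def right_polynomial_basis_def)
  qed
  have basis: "distinct xs" "V.basis (?h ` set xs)" "?h ` set xs \<subseteq> range ?h"
    if "right_minimal_basis R xs" for xs
    using that by (auto simp: right_minimal_basis_def right_polynomial_basis_def)
  show ?thesis
    unfolding ms[OF basis(1)[OF zs]] ms[OF basis(1)[OF ws]]
    by (rule V.min_weight_bases_same_weights[OF nullspace_fin_dim
          basis(2,3)[OF zs] min[OF zs] basis(2,3)[OF ws] min[OF ws]])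
qed

lemma right_minimal_indices_eq:
  assumes "right_minimal_basis R zs"
  shows "right_minimal_indices R = sort (map poly_vec_degree zs)"
  unfolding right_minimal_indices_def
proof (rule the_equality)
  fix es assume "\<exists>zs. right_minimal_basis R zs \<and> es = sort (map poly_vec_degree zs)"
  then obtain ws where "right_minimal_basis R ws" "es = sort (map poly_vec_degree ws)" by auto
  then show "es = sort (map poly_vec_degree zs)"
    using right_minimal_basis_degrees_unique[OF assms] properties_for_sort
    by (metis mset_sort sorted_sort)
qed (use assms in auto)

lemma right_polynomial_basis_length_eq:
  assumes "right_polynomial_basis R zs" "right_polynomial_basis R ws"
  shows "length zs = length ws"
proof -
  interpret V: vectorspace class_ring "nullspace_module R" by (rule nullspace_vectorspace)
  have "length xs = V.dim" if "right_polynomial_basis R xs" for xs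
  proof -
    have "length xs = card (map_vec to_fract ` set xs)"
      using that card_image[OF inj_on_subset[OF inj_map_vec_to_fract, of "set xs"]]
      by (simp add: right_polynomial_basis_def distinct_card)
    also have "\<dots> = V.dim"
      using that by (intro V.dim_basis[symmetric]) (auto simp: right_polynomial_basis_def)
    finally show ?thesis .
  qed
  then show ?thesis using assms by simp
qed

text \<open>That members are nonzero matters for the degree shift: the zero vector and its block
  both have \<open>poly_vec_degree\<close> 0, so they do not differ by \<open>s\<close>.\<close>

lemma right_polynomial_basis_mem:
  assumes "right_polynomial_basis R zs" "z \<in> set zs"
  shows "z \<in> carrier_vec (dim_col R)" "R *\<^sub>v z = 0\<^sub>v (dim_row R)" "z \<noteq> 0\<^sub>v (dim_col R)"
proof -
  interpret V: vectorspace class_ring "nullspace_module R" by (rule nullspace_vectorspace)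
  have B: "V.basis (map_vec to_fract ` set zs)"
    using assms by (simp add: right_polynomial_basis_def)
  then have mem: "map_vec to_fract z \<in> right_nullspace R"
    using assms(2) by (auto simp: V.basis_def)
  then show z: "z \<in> carrier_vec (dim_col R)" by (simp add: right_nullspace_iff)
  then show "R *\<^sub>v z = 0\<^sub>v (dim_row R)"
    using mem to_fract_vec_in_right_nullspace_iff by blast
  have "\<zero>\<^bsub>nullspace_module R\<^esub> \<notin> map_vec to_fract ` set zs"
    using B by (intro V.vs_zero_lin_dep) (auto simp: V.basis_def)
  then have "0\<^sub>v (dim_col R) \<notin> map_vec to_fract ` set zs" by (simp add: module_vec_simps)
  then have "map_vec to_fract z \<noteq> 0\<^sub>v (dim_col R)" using assms(2) by (metis imageI)
  then show "z \<noteq> 0\<^sub>v (dim_col R)" by simp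
qed

subsection \<open>Degrees\<close>

lemma poly_vec_degree_le_iff:
  "poly_vec_degree v \<le> k \<longleftrightarrow> (\<forall>i<dim_vec v. degree (v $ i) \<le> k)"
  by (auto simp: poly_vec_degree_def vec_set_def)

lemma degree_le_poly_vec_degree: "i < dim_vec v \<Longrightarrow> degree (v $ i) \<le> poly_vec_degree v"
  using poly_vec_degree_le_iff[of v "poly_vec_degree v"] by simp

lemma poly_vec_degree_attained:
  assumes "v \<in> carrier_vec n" "v \<noteq> 0\<^sub>v n"
  obtains i where "i < n" "v $ i \<noteq> 0" "degree (v $ i) = poly_vec_degree v"
proof -
  obtain j where j: "j < n" "v $ j \<noteq> 0" using assms by (metis carrier_vecD eq_vecI index_zero_vec)
  show ?thesis
  \<comment> \<open>In degree 0 the maximum may come from a zero entry, so the nonzero entry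
    \<open>j\<close> is used instead.\<close>
  proof (cases "poly_vec_degree v = 0")
    case True
    then show ?thesis using that[of j] j degree_le_poly_vec_degree[of j v] assms(1) by auto
  next
    case False
    have "poly_vec_degree v \<in> insert 0 (degree ` set\<^sub>v v)"
      unfolding poly_vec_degree_def by (rule Max_in) (auto simp: vec_set_def)
    then obtain i where "i < dim_vec v" "degree (v $ i) = poly_vec_degree v"
      using False by (auto simp: vec_set_def)
    then show ?thesis using that[of i] False assms(1) by force
  qed
qed

lemma degree_X_power_mult:
  fixes p :: "'a::idom poly"
  shows "p \<noteq> 0 \<Longrightarrow> degree ([:0, 1:] ^ k * p) = k + degree p"
  by (subst degree_mult_eq) (auto simp: degree_power_eq)

lemma degree_X_power_mult_le:
  fixes p :: "'a::idom poly"
  shows "degree ([:0, 1:] ^ k * p) \<le> k + degree p"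
  using degree_X_power_mult[of p k] by (cases "p = 0") simp_all

lemma pencil_carrier [simp]:
  "B \<in> carrier_mat m m \<Longrightarrow> A \<in> carrier_mat m m \<Longrightarrow> pencil B A \<in> carrier_mat m m"
  by (simp add: pencil_def)

lemma degree_pencil_mult_vec_le:
  assumes "A \<in> carrier_mat m m" "B \<in> carrier_mat m m" "u \<in> carrier_vec m" "k < m"
    and "\<And>i. i < m \<Longrightarrow> degree (u $ i) \<le> e"
  shows "degree ((pencil B A *\<^sub>v u) $ k) \<le> Suc e"
proof -
  have "(pencil B A *\<^sub>v u) $ k = (\<Sum>i<m. pencil B A $$ (k, i) * u $ i)"
    using assms by (simp add: pencil_def scalar_prod_def lessThan_atLeast0)
  also have "degree \<dots> \<le> Suc e"
  proof (rule degree_sum_le)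
    fix i assume "i \<in> {..<m}"
    then have i: "i < m" by simp
    have "degree (pencil B A $$ (k, i)) \<le> 1"
      using assms i by (simp add: pencil_def)
    then show "degree (pencil B A $$ (k, i) * u $ i) \<le> Suc e"
      using degree_mult_le[of "pencil B A $$ (k, i)" "u $ i"] assms(5)[OF i] by linarith
  qed simp
  finally show ?thesis .
qed

text \<open>Used in contrapositive form: a nonzero kernel vector of the pencil has a nonzero block
  \<open>x\<close>, so a leading term is available for the lower degree bound.\<close>

lemma kron_lift_zero:
  assumes "M \<in> carrier_mat ((s + 1) * n) ((s + 1) * n)"
  shows "kron_lift n s t M (0\<^sub>v n) = 0\<^sub>v ((s + 1) * n + s * n)"
proof -
  have zero: "C *\<^sub>v 0\<^sub>v q = 0\<^sub>v p" if "C \<in> carrier_mat p q" for C :: "'a mat" and p q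
    using that by (intro eq_vecI) auto
  have P: "power_col s t \<otimes>\<^sub>K 1\<^sub>m n \<in> carrier_mat ((s + 1) * n) n"
    by (rule power_col_kron_carrier)
  show ?thesis
    unfolding kron_lift_def Let_def zero[OF P] zero[OF assms]
  proof (rule eq_vec_blocksI[of _ "s + 1 + s" n])
    fix i a assume ia: "i < s + 1 + s" "a < n"
    have less: "j * n + a < (s + 1) * n" if "j < s + 1" for j
      using block_index_less[OF that ia(2)] .
    show "(0\<^sub>v ((s + 1) * n) @\<^sub>v vec (s * n) (\<lambda>k. \<Sum>j\<le>k div n. t ^ (k div n - j) *
        0\<^sub>v ((s + 1) * n) $ (j * n + k mod n))) $ (i * n + a) = 0\<^sub>v ((s + 1) * n + s * n) $ (i * n + a)"
    proof (cases "i < s + 1")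
      case True
      then show ?thesis using less[of i] by simp
    next
      case False
      then obtain k where k: "i = s + 1 + k" "k < s" using ia by (metis add_diff_inverse_nat nat_add_left_cancel_less)
      have eq: "i * n + a = (s + 1) * n + (k * n + a)" unfolding k(1) by (simp add: algebra_simps)
      have "k * n + a < s * n" using k ia by (intro block_index_less)
      moreover have "(\<Sum>j\<le>k. t ^ (k - j) * 0\<^sub>v ((s + 1) * n) $ (j * n + a)) = 0"
        using less k by (intro sum.neutral) (auto simp del: mult_Suc)
      ultimately show ?thesis unfolding eq using ia by simp
    qed
  qed (auto simp: algebra_simps intro!: carrier_vecI)
qed

text \<open>The first block of \<open>u\<close> is \<open>x\<close> times the \<open>s\<close>-th
  power of the indeterminate, which gives the lower bound. For the upper bound, \<open>u\<close>
  obeys it directly, the pencil adds at most 1 to the degree, and solving for a block of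
  \<open>y\<close> takes that 1 away again.\<close>

lemma kron_pencil_kernel_degree:
  assumes A: "A \<in> carrier_mat ((s + 1) * n) ((s + 1) * n)"
    and B: "B \<in> carrier_mat ((s + 1) * n) ((s + 1) * n)"
    and c: "c * c = 1" and s: "s \<ge> 1"
    and z: "z \<in> carrier_vec ((s + 1) * n + s * n)" "z \<noteq> 0\<^sub>v ((s + 1) * n + s * n)"
    and 0: "kron_pencil n s [:0, 1:] c (pencil B A) *\<^sub>v z = 0\<^sub>v ((s + 1) * n + s * n)"
  shows "poly_vec_degree z = poly_vec_degree (vec_block n (s + 1) z) + s"
proof -
  let ?t = "[:0, 1:] :: 'a poly" and ?M = "pencil B A"
  define x where "x = vec_block n (s + 1) z"
  define D where "D = poly_vec_degree x"
  have M: "?M \<in> carrier_mat ((s + 1) * n) ((s + 1) * n)" using A B by simp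
  have x: "x \<in> carrier_vec n" by (simp add: x_def)
  have zx: "z = kron_lift n s ?t ?M x"
    unfolding x_def by (rule kron_pencil_kernelD(2)[OF M c s z(1) 0])
  then have x0: "x \<noteq> 0\<^sub>v n" using kron_lift_zero[OF M, of ?t] z(2) by auto
  define u where "u = (power_col s ?t \<otimes>\<^sub>K 1\<^sub>m n) *\<^sub>v x"
  define y where "y = vec_last z (s * n)"
  have P: "power_col s ?t \<otimes>\<^sub>K 1\<^sub>m n \<in> carrier_mat ((s + 1) * n) n"
    by (rule power_col_kron_carrier)
  have u: "u \<in> carrier_vec ((s + 1) * n)" unfolding u_def using P x by auto
  have y: "y \<in> carrier_vec (s * n)" unfolding y_def by simp
  have "vec_first z ((s + 1) * n) = u"
    unfolding zx kron_lift_def Let_def u_def[symmetric] using u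
    by (intro eq_vecI) (auto simp: vec_first_def)
  then have zuy: "z = u @\<^sub>v y"
    unfolding y_def using vec_first_last_append[OF z(1)] by simp
  note eqs = 0[unfolded zuy kron_pencil_mult_eq_0_iff[OF M c u y]]
  have ui: "u $ (i * n + a) = ?t ^ (s - i) * x $ a" if "i \<le> s" "a < n" for i a
    unfolding u_def by (rule power_col_kron_mult_index[OF x that])
  have u_le: "degree (u $ k) \<le> s + D" if k: "k < (s + 1) * n" for k
  proof -
    have "n > 0" using k by (cases n) auto
    then have ka: "k mod n < n" "k div n < s + 1" using k by (simp_all add: less_mult_imp_div_less)
    have le: "degree (x $ (k mod n)) \<le> D"
      unfolding D_def using ka x by (intro degree_le_poly_vec_degree) auto
    have "u $ (k div n * n + k mod n) = ?t ^ (s - k div n) * x $ (k mod n)"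
      using ka by (intro ui) auto
    then have eq: "u $ k = ?t ^ (s - k div n) * x $ (k mod n)"
      by (simp only: div_mult_mod_eq)
    show ?thesis
      unfolding eq by (rule order_trans[OF degree_X_power_mult_le]) (use le in linarith)
  qed
  have w_le: "degree ((?M *\<^sub>v u) $ k) \<le> Suc (s + D)" if "k < (s + 1) * n" for k
    by (rule degree_pencil_mult_vec_le[OF A B u that u_le])
  have shift: "degree p \<le> s + D" if "degree (?t * p) \<le> Suc (s + D)" for p
    using that degree_X_power_mult[of p 1] by (cases "p = 0") auto
  \<comment> \<open>Forward substitution would only give a bound growing with \<open>i\<close>; solving from the last block row
    backwards divides by the indeterminate in each step.\<close>
  have y_le: "degree (y $ (i * n + a)) \<le> s + D" if i: "i < s" and a: "a < n" for i a
  proof -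
    \<comment> \<open>Block equation \<open>Suc i\<close> is solved for block \<open>i\<close> of
      \<open>y\<close>. The absent block \<open>s\<close> counts as zero, which starts the
      descent.\<close>
    have recur: "degree (y $ (i * n + a)) \<le> s + D"
      if "i < s" "degree (if Suc i = s then 0 else y $ (Suc i * n + a)) \<le> Suc (s + D)" for i
    proof (rule shift)
      have eq: "(?M *\<^sub>v u) $ (Suc i * n + a) + ?t * y $ (i * n + a)
          = (if Suc i = s then 0 else y $ (Suc i * n + a))"
        using conjunct2[OF eqs, rule_format, of "Suc i" a] that(1) a by simp
      have "degree ((?M *\<^sub>v u) $ (Suc i * n + a)) \<le> Suc (s + D)"
        using that(1) a by (intro w_le block_index_less) auto
      from degree_diff_le[OF that(2) this]
      show "degree (?t * y $ (i * n + a)) \<le> Suc (s + D)"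
        unfolding eq[symmetric] add_diff_cancel_left' .
    qed
    have "i \<le> s - 1" using i by simp
    then show ?thesis
    proof (induction rule: inc_induct)
      case base
      then show ?case using s by (intro recur) auto
    next
      case (step m)
      then show ?case by (intro recur) auto
    qed
  qed
  have "poly_vec_degree z \<le> s + D"
    unfolding poly_vec_degree_le_iff
  proof (intro allI impI)
    fix k assume k: "k < dim_vec z"
    show "degree (z $ k) \<le> s + D"
    proof (cases "k < (s + 1) * n")
      case True
      then show ?thesis using u y u_le unfolding zuy by auto
    next
      case False
      define l where "l = k - (s + 1) * n"
      have l: "l < s * n" "z $ k = y $ l" using False k u y unfolding zuy l_def by auto
      have "n > 0" using l by (cases n) auto
      then have "l mod n < n" "l div n < s" using l by (simp_all add: less_mult_imp_div_less)
      from y_le[OF this(2,1)] show ?thesis using l by simp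
    qed
  qed
  moreover have "s + D \<le> poly_vec_degree z"
  proof -
    obtain a where a: "a < n" "x $ a \<noteq> 0" "degree (x $ a) = D"
      using poly_vec_degree_attained[OF x x0] unfolding D_def by blast
    have less: "a < (s + 1) * n" using block_index_less[of 0 "s + 1" a n] a by simp
    then have "z $ a = ?t ^ s * x $ a"
      using ui[of 0 a] a u unfolding zuy by simp
    then have "degree (z $ a) = s + D" using degree_X_power_mult[OF a(2), of s] a(3) by (simp only:)
    then show ?thesis using degree_le_poly_vec_degree[of a z] less z(1) by simp
  qed
  ultimately show ?thesis by (simp add: x_def D_def)
qed

subsection \<open>The nullspace isomorphism\<close>

lemma L_mat_eq_shift_mat: "L_mat k = shift_mat k [:0, 1:]"
  unfolding L_mat_def shift_mat_def ..

lemma Lambda_mat_eq_power_col: "Lambda_mat k = power_col k [:0, 1:]"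
  unfolding Lambda_mat_def power_col_def
  by (intro eq_matI) (auto simp: monom_altdef)

lemma block_kronecker_pencil_eq:
  "block_kronecker_pencil n s \<sigma> B A = kron_pencil n s [:0, 1:] [:\<sigma>:] (pencil B A)"
  by (simp only: block_kronecker_pencil_def kron_pencil_def L_mat_eq_shift_mat)

section \<open>Compatibility with ring homomorphisms\<close>

context comm_ring_hom
begin

lemma map_kronecker_one: "map_mat hom (A \<otimes>\<^sub>K 1\<^sub>m n) = map_mat hom A \<otimes>\<^sub>K 1\<^sub>m n"
proof (rule eq_matI)
  fix i j
  assume "i < dim_row (map_mat hom A \<otimes>\<^sub>K 1\<^sub>m n)" "j < dim_col (map_mat hom A \<otimes>\<^sub>K 1\<^sub>m n)"
  then have ij: "i < dim_row A * n" "j < dim_col A * n" by (simp_all add: kronecker_prod_def)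
  then have "n > 0" by (cases n) auto
  then show "map_mat hom (A \<otimes>\<^sub>K 1\<^sub>m n) $$ (i, j) = (map_mat hom A \<otimes>\<^sub>K 1\<^sub>m n) $$ (i, j)"
    using ij by (simp add: kronecker_prod_def hom_mult less_mult_imp_div_less)
qed (simp_all add: kronecker_prod_def)

lemma map_shift_mat: "map_mat hom (shift_mat k t) = shift_mat k (hom t)"
  by (intro eq_matI) (auto simp: shift_mat_def hom_uminus)

lemma map_power_col: "map_mat hom (power_col k t) = power_col k (hom t)"
  by (intro eq_matI) (auto simp: power_col_def hom_power)

lemma map_kron_pencil:
  assumes "M \<in> carrier_mat ((s + 1) * n) ((s + 1) * n)"
  shows "map_mat hom (kron_pencil n s t c M) = kron_pencil n s (hom t) (hom c) (map_mat hom M)"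
proof -
  have T: "(shift_mat s t)\<^sup>T \<otimes>\<^sub>K 1\<^sub>m n \<in> carrier_mat ((s + 1) * n) (s * n)"
    by (rule kronecker_prod_carrier) auto
  have S: "(c \<cdot>\<^sub>m shift_mat s t) \<otimes>\<^sub>K 1\<^sub>m n \<in> carrier_mat (s * n) ((s + 1) * n)"
    by (rule kronecker_prod_carrier) auto
  have "map_mat hom (0\<^sub>m (s * n) (s * n)) = 0\<^sub>m (s * n) (s * n)"
    by (intro eq_matI) auto
  moreover have "map_mat hom (c \<cdot>\<^sub>m shift_mat s t) = hom c \<cdot>\<^sub>m map_mat hom (shift_mat s t)"
    by (intro eq_matI) (auto simp: hom_mult)
  moreover have "map_mat hom ((shift_mat s t)\<^sup>T) = (map_mat hom (shift_mat s t))\<^sup>T"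
    by (intro eq_matI) auto
  ultimately show ?thesis
    unfolding kron_pencil_def map_four_block_mat[OF assms T S zero_carrier_mat]
    by (simp add: map_kronecker_one map_shift_mat)
qed

end

lemma sort_map_mono: "mono f \<Longrightarrow> sort (map f xs) = map f (sort xs)"
  by (rule properties_for_sort)
    (auto simp: sorted_wrt_map monoD intro: sorted_wrt_mono_rel[OF _ sorted_sort])

lemma mono_add_right: "mono (\<lambda>k. k + c :: nat)"
  by (simp add: mono_def)

text \<open>The sign is recorded as \<open>\<sigma> * \<sigma> = 1\<close>, a form that carries over
  to constant polynomials and to rational functions.\<close>

locale kronecker_linearization =
  fixes n s :: nat and \<sigma> :: "'a::field" and A B :: "'a mat" and P :: "'a poly mat"
  assumes A: "A \<in> carrier_mat ((s + 1) * n) ((s + 1) * n)"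
    and B: "B \<in> carrier_mat ((s + 1) * n) ((s + 1) * n)"
    and P: "((Lambda_mat s)\<^sup>T \<otimes>\<^sub>K 1\<^sub>m n) * pencil B A * (Lambda_mat s \<otimes>\<^sub>K 1\<^sub>m n) = P"
    and \<sigma>: "\<sigma> * \<sigma> = 1" and s: "s \<ge> 1"
begin

abbreviation "\<L> \<equiv> block_kronecker_pencil n s \<sigma> B A"

lemma M: "pencil B A \<in> carrier_mat ((s + 1) * n) ((s + 1) * n)"
  using A B by (rule pencil_carrier[rotated])

lemma M_fract: "map_mat to_fract (pencil B A) \<in> carrier_mat ((s + 1) * n) ((s + 1) * n)"
  using M by simp

lemma \<sigma>_poly: "[:\<sigma>:] * [:\<sigma>:] = 1"
  by (simp add: \<sigma>)

lemma \<sigma>_fract: "to_fract [:\<sigma>:] * to_fract [:\<sigma>:] = 1"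
  using arg_cong[OF \<sigma>_poly, of to_fract] by (simp only: to_fract_mult to_fract_1)

lemma pencil_dims [simp]:
  "dim_row \<L> = (s + 1) * n + s * n" "dim_col \<L> = (s + 1) * n + s * n"
  using kron_pencil_carrier[OF M, of "[:0, 1:]" "[:\<sigma>:]"]
  unfolding block_kronecker_pencil_eq[symmetric] by (simp_all only: carrier_matD)

lemma P_eq:
  "P = ((power_col s [:0, 1:])\<^sup>T \<otimes>\<^sub>K 1\<^sub>m n) * pencil B A * (power_col s [:0, 1:] \<otimes>\<^sub>K 1\<^sub>m n)"
  using P by (simp only: Lambda_mat_eq_power_col)

lemma P_dims [simp]: "dim_row P = n" "dim_col P = n"
  by (simp_all add: P_eq kronecker_prod_def power_col_def)

lemma map_P:
  "map_mat to_fract P = ((power_col s (to_fract [:0, 1:]))\<^sup>T \<otimes>\<^sub>K 1\<^sub>m n) * map_mat to_fract (pencil B A)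
     * (power_col s (to_fract [:0, 1:]) \<otimes>\<^sub>K 1\<^sub>m n)"
proof -
  let ?C = "power_col s [:0, 1:] :: 'a poly mat"
  have Q: "?C\<^sup>T \<otimes>\<^sub>K 1\<^sub>m n \<in> carrier_mat n ((s + 1) * n)"
    by (rule power_row_kron_carrier)
  have R: "?C \<otimes>\<^sub>K 1\<^sub>m n \<in> carrier_mat ((s + 1) * n) n"
    by (rule power_col_kron_carrier)
  have "map_mat to_fract (?C\<^sup>T) = (map_mat to_fract ?C)\<^sup>T" by (intro eq_matI) auto
  then show ?thesis
    unfolding P_eq to_fract_hom.mat_hom_mult[OF mult_carrier_mat[OF Q M] R]
      to_fract_hom.mat_hom_mult[OF Q M]
    by (simp only: to_fract_hom.map_kronecker_one to_fract_hom.map_power_col)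
qed

lemma map_pencil:
  "map_mat to_fract \<L> =
     kron_pencil n s (to_fract [:0, 1:]) (to_fract [:\<sigma>:]) (map_mat to_fract (pencil B A))"
  unfolding block_kronecker_pencil_eq by (rule to_fract_hom.map_kron_pencil[OF M])

lemma vec_block_in_right_nullspace:
  assumes "z \<in> right_nullspace \<L>"
  shows "vec_block n (s + 1) z \<in> right_nullspace P"
    and "z = kron_lift n s (to_fract [:0, 1:]) (map_mat to_fract (pencil B A)) (vec_block n (s + 1) z)"
proof -
  have z: "z \<in> carrier_vec ((s + 1) * n + s * n)"
    and 0: "kron_pencil n s (to_fract [:0, 1:]) (to_fract [:\<sigma>:]) (map_mat to_fract (pencil B A)) *\<^sub>v z
      = 0\<^sub>v ((s + 1) * n + s * n)"
    using assms unfolding right_nullspace_iff pencil_dims map_pencil by blast+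
  note D = kron_pencil_kernelD[OF M_fract \<sigma>_fract s z 0]
  show "vec_block n (s + 1) z \<in> right_nullspace P"
    unfolding right_nullspace_iff P_dims map_P using D(1) by simp
  show "z = kron_lift n s (to_fract [:0, 1:]) (map_mat to_fract (pencil B A)) (vec_block n (s + 1) z)"
    by (rule D(2))
qed

lemma vec_block_linear:
  "linear_map class_ring (nullspace_module \<L>) (nullspace_module P) (vec_block n (s + 1))"
proof (rule linear_map_nullspaceI)
  have less: "s * n + i < (s + 1) * n + s * n" if "i < n" for i using that by simp
  show "vec_block n (s + 1) (x + y) = vec_block n (s + 1) x + vec_block n (s + 1) y"
    if "x \<in> right_nullspace \<L>" "y \<in> right_nullspace \<L>" for x y
    using that less by (intro eq_vecI) (auto simp: right_nullspace_iff vec_block_def)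
  show "vec_block n (s + 1) (c \<cdot>\<^sub>v x) = c \<cdot>\<^sub>v vec_block n (s + 1) x"
    if "x \<in> right_nullspace \<L>" for c x
    using that less by (intro eq_vecI) (auto simp: right_nullspace_iff vec_block_def)
qed (rule vec_block_in_right_nullspace)

text \<open>A kernel vector is the lift of its own block, hence determined by it.\<close>

lemma vec_block_inj: "inj_on (vec_block n (s + 1)) (right_nullspace \<L>)"
  by (rule inj_onI) (metis vec_block_in_right_nullspace(2))

lemma vec_block_surj: "vec_block n (s + 1) ` right_nullspace \<L> = right_nullspace P"
proof
  show "right_nullspace P \<subseteq> vec_block n (s + 1) ` right_nullspace \<L>"
  proof
    fix x assume "x \<in> right_nullspace P"
    then have x: "x \<in> carrier_vec n" and 0: "map_mat to_fract P *\<^sub>v x = 0\<^sub>v n"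
      by (simp_all add: right_nullspace_iff)
    note L = kron_lift_kernel[OF M_fract \<sigma>_fract s x 0[unfolded map_P]]
    have "kron_lift n s (to_fract [:0, 1:]) (map_mat to_fract (pencil B A)) x \<in> right_nullspace \<L>"
      unfolding right_nullspace_iff pencil_dims map_pencil by (rule conjI[OF L(1,2)])
    then show "x \<in> vec_block n (s + 1) ` right_nullspace \<L>"
      by (rule rev_image_eqI) (rule L(3)[symmetric])
  qed
qed (use vec_block_in_right_nullspace in blast)

section \<open>Transfer of polynomial bases\<close>

lemma vec_block_to_fract:
  assumes "z \<in> carrier_vec ((s + 1) * n + s * n)"
  shows "vec_block n (s + 1) (map_vec to_fract z) = map_vec to_fract (vec_block n (s + 1) z)"
proof -
  have "s * n + i < (s + 1) * n + s * n" if "i < n" for i using that by simp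
  then show ?thesis using assms by (intro eq_vecI) (auto simp: vec_block_def)
qed

lemma vec_block_image_to_fract:
  assumes "Z \<subseteq> carrier_vec ((s + 1) * n + s * n)"
  shows "vec_block n (s + 1) ` map_vec to_fract ` Z = map_vec to_fract ` vec_block n (s + 1) ` Z"
  unfolding image_image using assms vec_block_to_fract by (intro image_cong) auto

text \<open>Taking the block commutes with the embedding of polynomials into rational functions, so
  the isomorphism of rational nullspaces can be applied to polynomial families.\<close>

lemma right_polynomial_basis_vec_block:
  assumes zs: "right_polynomial_basis \<L> zs"
  shows "right_polynomial_basis P (map (vec_block n (s + 1)) zs)"
    and "map poly_vec_degree zs = map (\<lambda>\<epsilon>. \<epsilon> + s) (map poly_vec_degree (map (vec_block n (s + 1)) zs))"
proof -
  interpret V: vectorspace class_ring "nullspace_module \<L>" by (rule nullspace_vectorspace)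
  have basis: "V.basis (map_vec to_fract ` set zs)" and dist: "distinct zs"
    using zs by (simp_all add: right_polynomial_basis_def)
  note mem = right_polynomial_basis_mem[OF zs, unfolded pencil_dims]
  have null: "map_vec to_fract z \<in> right_nullspace \<L>" if "z \<in> set zs" for z
    using that mem(1,2) to_fract_vec_in_right_nullspace_iff[of z \<L>] unfolding pencil_dims by blast
  have "inj_on (vec_block n (s + 1)) (set zs)"
  proof (rule inj_onI)
    fix v w assume vw: "v \<in> set zs" "w \<in> set zs" "vec_block n (s + 1) v = vec_block n (s + 1) w"
    then have "vec_block n (s + 1) (map_vec to_fract v) = vec_block n (s + 1) (map_vec to_fract w)"
      using mem(1) by (simp only: vec_block_to_fract)
    then have "map_vec to_fract v = map_vec to_fract w"
      by (rule inj_onD[OF vec_block_inj _ null[OF vw(1)] null[OF vw(2)]])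
    then show "v = w" by (rule injD[OF inj_map_vec_to_fract])
  qed
  moreover have "vectorspace.basis class_ring (nullspace_module P)
      (vec_block n (s + 1) ` map_vec to_fract ` set zs)"
  proof (rule linear_map.linear_inj_image_is_basis[OF vec_block_linear _ _ basis nullspace_fin_dim])
    show "inj_on (vec_block n (s + 1)) (carrier (nullspace_module \<L>))"
      using vec_block_inj by simp
    show "vec_block n (s + 1) ` carrier (nullspace_module \<L>) = carrier (nullspace_module P)"
      using vec_block_surj by simp
  qed
  moreover have "vec_block n (s + 1) ` map_vec to_fract ` set zs
      = map_vec to_fract ` set (map (vec_block n (s + 1)) zs)"
    unfolding set_map by (rule vec_block_image_to_fract) (rule subsetI, rule mem(1))
  ultimately show "right_polynomial_basis P (map (vec_block n (s + 1)) zs)"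
    unfolding right_polynomial_basis_def distinct_map using dist by metis
  have "poly_vec_degree z = poly_vec_degree (vec_block n (s + 1) z) + s" if "z \<in> set zs" for z
    by (rule kron_pencil_kernel_degree[OF A B \<sigma>_poly s mem(1,3,2)[OF that,
          unfolded block_kronecker_pencil_eq]])
  then show "map poly_vec_degree zs
      = map (\<lambda>\<epsilon>. \<epsilon> + s) (map poly_vec_degree (map (vec_block n (s + 1)) zs))"
    by simp
qed

text \<open>The inverse isomorphism is given by a formula without division, so it lifts polynomial
  vectors to polynomial vectors. Thus no polynomial basis for \<open>P\<close> is missed when
  minimality is compared.\<close>

lemma right_polynomial_basis_lift:
  assumes xs: "right_polynomial_basis P xs"
  obtains zs where "right_polynomial_basis \<L> zs" "map (vec_block n (s + 1)) zs = xs"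
proof -
  interpret V: vectorspace class_ring "nullspace_module \<L>" by (rule nullspace_vectorspace)
  let ?l = "kron_lift n s [:0, 1:] (pencil B A)"
  define zs where "zs = map ?l xs"
  note mem = right_polynomial_basis_mem[OF xs, unfolded P_dims]
  have lift: "?l x \<in> carrier_vec ((s + 1) * n + s * n)" "\<L> *\<^sub>v ?l x = 0\<^sub>v ((s + 1) * n + s * n)"
    "vec_block n (s + 1) (?l x) = x" if "x \<in> set xs" for x
    using kron_lift_kernel[OF M \<sigma>_poly s mem(1)[OF that] mem(2)[OF that, unfolded P_eq]]
    unfolding block_kronecker_pencil_eq by blast+
  have block: "map (vec_block n (s + 1)) zs = xs"
    unfolding zs_def map_map by (rule map_idI) (simp only: o_apply lift(3))
  have carrier: "set zs \<subseteq> carrier_vec ((s + 1) * n + s * n)"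
    using lift(1) by (auto simp: zs_def)
  have null: "map_vec to_fract ` set zs \<subseteq> right_nullspace \<L>"
  proof
    fix y assume "y \<in> map_vec to_fract ` set zs"
    then obtain x where "x \<in> set xs" "y = map_vec to_fract (?l x)" by (auto simp: zs_def)
    then show "y \<in> right_nullspace \<L>"
      using lift to_fract_vec_in_right_nullspace_iff[of "?l x" \<L>] unfolding pencil_dims by blast
  qed
  have "vec_block n (s + 1) ` map_vec to_fract ` set zs = map_vec to_fract ` set xs"
    unfolding vec_block_image_to_fract[OF carrier] by (simp flip: block)
  then have "vectorspace.basis class_ring (nullspace_module P)
      (vec_block n (s + 1) ` map_vec to_fract ` set zs)"
    using xs by (simp add: right_polynomial_basis_def)
  then have "V.basis (map_vec to_fract ` set zs)"
  proof (rule linear_map.basis_of_basis_image[OF vec_block_linear _ _ nullspace_fin_dim, rotated -1])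
    show "inj_on (vec_block n (s + 1)) (carrier (nullspace_module \<L>))"
      using vec_block_inj by simp
    show "vec_block n (s + 1) ` carrier (nullspace_module \<L>) = carrier (nullspace_module P)"
      using vec_block_surj by simp
    show "map_vec to_fract ` set zs \<subseteq> carrier (nullspace_module \<L>)"
      using null by simp
  qed
  moreover have "distinct zs"
    using xs block by (metis distinct_map right_polynomial_basis_def)
  ultimately show ?thesis
    using that block by (simp add: right_polynomial_basis_def)
qed

section \<open>Transfer of minimality\<close>

lemma sum_degrees_vec_block:
  assumes "right_polynomial_basis \<L> zs"
  shows "sum_list (map poly_vec_degree zs)
    = sum_list (map poly_vec_degree (map (vec_block n (s + 1)) zs)) + length zs * s"
  unfolding right_polynomial_basis_vec_block(2)[OF assms]
  by (simp add: o_def sum_list_addf sum_list_triv)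

text \<open>Both degree sums shift by \<open>s\<close> times the common length of all bases. From
  left to right a competitor for \<open>P\<close> must first be lifted; from right to left a
  competitor for the pencil is only projected.\<close>

lemma right_minimal_basis_vec_block_iff:
  assumes zs: "right_polynomial_basis \<L> zs"
  shows "right_minimal_basis \<L> zs \<longleftrightarrow> right_minimal_basis P (map (vec_block n (s + 1)) zs)"
proof
  assume min: "right_minimal_basis \<L> zs"
  show "right_minimal_basis P (map (vec_block n (s + 1)) zs)"
    unfolding right_minimal_basis_def
  proof (intro conjI allI impI right_polynomial_basis_vec_block(1)[OF zs])
    fix ws assume "right_polynomial_basis P ws"
    then obtain ys where ys: "right_polynomial_basis \<L> ys" "map (vec_block n (s + 1)) ys = ws"
      by (rule right_polynomial_basis_lift)
    then have "sum_list (map poly_vec_degree zs) \<le> sum_list (map poly_vec_degree ys)"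
      using min by (simp add: right_minimal_basis_def)
    then show "sum_list (map poly_vec_degree (map (vec_block n (s + 1)) zs))
        \<le> sum_list (map poly_vec_degree ws)"
      unfolding sum_degrees_vec_block[OF zs] sum_degrees_vec_block[OF ys(1)] ys(2)
        right_polynomial_basis_length_eq[OF zs ys(1)] by simp
  qed
next
  assume min: "right_minimal_basis P (map (vec_block n (s + 1)) zs)"
  show "right_minimal_basis \<L> zs"
    unfolding right_minimal_basis_def
  proof (intro conjI allI impI zs)
    fix ys assume ys: "right_polynomial_basis \<L> ys"
    then have "sum_list (map poly_vec_degree (map (vec_block n (s + 1)) zs))
        \<le> sum_list (map poly_vec_degree (map (vec_block n (s + 1)) ys))"
      using min right_polynomial_basis_vec_block(1) unfolding right_minimal_basis_def by blast
    then show "sum_list (map poly_vec_degree zs) \<le> sum_list (map poly_vec_degree ys)"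
      unfolding sum_degrees_vec_block[OF zs] sum_degrees_vec_block[OF ys]
        right_polynomial_basis_length_eq[OF zs ys] by simp
  qed
qed

text \<open>One minimal basis of the pencil computes both lists, since its blocks form a minimal
  basis for \<open>P\<close>; adding \<open>s\<close> is monotone and so commutes with
  sorting.\<close>

lemma right_minimal_indices_shift:
  "right_minimal_indices \<L> = map (\<lambda>\<epsilon>. \<epsilon> + s) (right_minimal_indices P)"
proof -
  obtain zs where min: "right_minimal_basis \<L> zs" using right_minimal_basis_exists by blast
  then have zs: "right_polynomial_basis \<L> zs" by (simp add: right_minimal_basis_def)
  let ?ds = "map poly_vec_degree (map (vec_block n (s + 1)) zs)"
  have "right_minimal_indices P = sort ?ds"
    using min zs right_minimal_basis_vec_block_iff by (intro right_minimal_indices_eq) blast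
  moreover have "right_minimal_indices \<L> = sort (map (\<lambda>\<epsilon>. \<epsilon> + s) ?ds)"
    by (simp only: right_minimal_indices_eq[OF min] right_polynomial_basis_vec_block(2)[OF zs])
  ultimately show ?thesis by (simp only: sort_map_mono[OF mono_add_right])
qed

end

theorem theorem7p2:
  fixes P :: "'a::field poly mat" and A B :: "'a mat" and \<sigma> :: 'a and n d s :: nat
  assumes "P \<in> carrier_mat n n"
    and "singular_poly_mat P"
    and "poly_mat_degree P = d"
    and "odd d"
    and "s = (d - 1) div 2"
    and "s \<ge> 1"
    and "A \<in> carrier_mat ((s + 1) * n) ((s + 1) * n)"
    and "B \<in> carrier_mat ((s + 1) * n) ((s + 1) * n)"
    and "((Lambda_mat s)\<^sup>T \<otimes>\<^sub>K 1\<^sub>m n) * pencil B A * (Lambda_mat s \<otimes>\<^sub>K 1\<^sub>m n) = P"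
    and "\<sigma> \<in> {1, -1}"
  shows "(\<forall>zs. right_minimal_basis (block_kronecker_pencil n s \<sigma> B A) zs \<longrightarrow>
            right_minimal_basis P (map (vec_block n (s + 1)) zs)) \<and>
         right_minimal_indices (block_kronecker_pencil n s \<sigma> B A) =
            map (\<lambda>\<epsilon>. \<epsilon> + s) (right_minimal_indices P)"
proof -
  interpret kronecker_linearization n s \<sigma> A B P
    using assms by unfold_locales auto
  show ?thesis
    using right_minimal_basis_vec_block_iff right_minimal_indices_shift
    by (auto simp: right_minimal_basis_def)
qed

end
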